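(* Let $d$ be a positive integer and let $f:\mathcal X\times\mathcal Y\to\mathcal Z$ be a doubly-conditionally bijective function of order $d^2$ whose multiplication table is the multiplication table of a tightly network codeable (TNC) group of order $d^2$. For any integers $d_1,d_2$ with $d\le d_1,d_2<d^2=|\mathcal X|$, $$\max\{P_S^f(\mathbf C(d_1,d_2)),P_S^f(\mathbf C^E(d_1,d_2)),P_S^f(\mathbf C^N(d_1,d_2)),P_S^f(\mathbf Q(d_1,d_2))\}\le\frac{\min\{d_1,d_2\}}{d^2}<1=P_S^f(\mathbf Q^E(d_1,d_2)).$$ Moreover, if $f=\oplus_d^2:\mathbb Z_d^2\times\mathbb Z_d^2\to\mathbb Z_d^2$, $(q,r)\oplus_d^2(s,t)=(q+s\bmod d,r+t\bmod d)$, and there exist integers $d_1'\le d_3'$ and $d_2'\le d_4'$, all dividing $d$, such that $d_1=d_1'd_2'$ and $d_2=d_3'd_4'$, then the maximum and first inequality can be replaced by an equality, i.e. each of $P_S^f(\mathbf C(d_1,d_2))$, $P_S^f(\mathbf C^E(d_1,d_2))$, $P_S^f(\mathbf C^N(d_1,d_2))$, $P_S^f(\mathbf Q(d_1,d_2))$ equals $\min\{d_1,d_2\}/d^2$.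
   Context: A function $f:\mathcal X\times\mathcal Y\to\mathcal Z$ of finite alphabets is doubly-conditionally bijective (DCB) if for every $y$ the map $x\mapsto f(x,y)$ is a bijection $\mathcal X\to\mathcal Z$ and for every $x$ the map $y\mapsto f(x,y)$ is a bijection $\mathcal Y\to\mathcal Z$; it has order $m$ if $|\mathcal X|=m$. Its multiplication table is the array with entry $f(x,y)$ at $(x,y)$; being the multiplication table of a group $(G,\cdot)$ means that, identifying $\mathcal X,\mathcal Y,\mathcal Z$ with $G$, $f(g,h)=g\cdot h$. A group $(G,\cdot)$ of order $d^2$ is TNC if there are unitaries $\{U_g\}_{g\in G}$ on $\mathbb C^d$ with $\mathrm{Tr}[U_g^\dagger U_h]=d\,\delta_{g,h}$ and unit-modulus numbers $\omega(g,h)$ with $U_gU_h=\omega(g,h)U_{g\cdot h}$ for all $g,h\in G$. All Hilbert spaces are finite-dimensional. Sets of conditional distributions $Q(z|x,y)$ ($a\in\{0,\dots,d_1-1\}$, $b\in\{0,\dots,d_2-1\}$): - $\mathbf C(d_1,d_2)$: $Q(z|x,y)=\sum_{a,b}R(z|a,b)P_1(a|x)P_2(b|y)$ for conditional distributions $P_1,P_2,R$. - $\mathbf C^N(d_1,d_2)$: $Q(z|x,y)=\sum_{a,b}R(z|a,b)N(a,b|x,y)$ with $N$ bipartite nonsignaling (marginal of $a$ independent of $y$, marginal of $b$ independent of $x$). - $\mathbf C^E(d_1,d_2)$: as $\mathbf C^N$ with $N(a,b|x,y)=\mathrm{Tr}[(M_a^x\otimes N_b^y)\rho_{AB}]$ for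 a bipartite state $\rho_{AB}$ and POVMs $\{M^x_a\}_a,\{N^y_b\}_b$. - $\mathbf Q(d_1,d_2)$: $Q(z|x,y)=\mathrm{Tr}[\Pi_z(\rho^x\otimes\sigma^y)]$ with states $\rho^x$ on $\mathbb C^{d_1}$, $\sigma^y$ on $\mathbb C^{d_2}$, and a POVM $\{\Pi_z\}$. - $\mathbf Q^E(d_1,d_2)$: $Q(z|x,y)=\mathrm{Tr}[\Pi_z(\mathcal E^x\otimes\mathcal F^y)(\rho_{AB})]$ with a bipartite state $\rho_{AB}$, quantum channels $\mathcal E^x:A\to\mathbb C^{d_1}$, $\mathcal F^y:B\to\mathbb C^{d_2}$, and a POVM $\{\Pi_z\}$. $P_S^f(Q)=\frac1{|\mathcal X||\mathcal Y|}\sum_{x,y}Q(f(x,y)|x,y)$ and $P_S^f(\mathbf S)=\sup_{Q\in\mathbf S}P_S^f(Q)$. *)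

theory Defs
  imports "HOL-Algebra.Group" "Jordan_Normal_Form.Schur_Decomposition"
begin

section \<open>Functions of two arguments and their multiplication tables\<close>

definition dcb :: "'x set \<Rightarrow> 'y set \<Rightarrow> 'z set \<Rightarrow> ('x \<Rightarrow> 'y \<Rightarrow> 'z) \<Rightarrow> bool" where
  "dcb X Y Z f \<longleftrightarrow> finite X \<and> finite Y \<and> finite Z \<and>
     (\<forall>y\<in>Y. bij_betw (\<lambda>x. f x y) X Z) \<and> (\<forall>x\<in>X. bij_betw (\<lambda>y. f x y) Y Z)"

definition dcb_of_order :: "nat \<Rightarrow> 'x set \<Rightarrow> 'y set \<Rightarrow> 'z set \<Rightarrow> ('x \<Rightarrow> 'y \<Rightarrow> 'z) \<Rightarrow> bool" where
  "dcb_of_order m X Y Z f \<longleftrightarrow> dcb X Y Z f \<and> card X = m"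

text \<open>The three alphabets are identified with the group by three separate bijections.\<close>

definition group_table ::
    "('g, 'm) monoid_scheme \<Rightarrow> 'x set \<Rightarrow> 'y set \<Rightarrow> 'z set \<Rightarrow> ('x \<Rightarrow> 'y \<Rightarrow> 'z) \<Rightarrow> bool" where
  "group_table G X Y Z f \<longleftrightarrow>
     (\<exists>\<phi> \<psi> \<chi>. bij_betw \<phi> X (carrier G) \<and> bij_betw \<psi> Y (carrier G) \<and> bij_betw \<chi> Z (carrier G) \<and>
        (\<forall>x\<in>X. \<forall>y\<in>Y. \<chi> (f x y) = \<phi> x \<otimes>\<^bsub>G\<^esub> \<psi> y))"

definition Zd2 :: "nat \<Rightarrow> (nat \<times> nat) set" where
  "Zd2 d = {..<d} \<times> {..<d}"

definition add_Zd2 :: "nat \<Rightarrow> nat \<times> nat \<Rightarrow> nat \<times> nat \<Rightarrow> nat \<times> nat" where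
  "add_Zd2 d = (\<lambda>(q, r) (s, t). ((q + s) mod d, (r + t) mod d))"

section \<open>Matrices, states, measurements and channels\<close>

text \<open>Operators on the Hilbert space of dimension \<open>n\<close> are elements of
  \<open>carrier_mat n n\<close>. On a tensor product of dimensions \<open>m\<close> and \<open>n\<close>, the index
  \<open>i * n + k\<close> stands for the product basis vector number \<open>i\<close> on the left and \<open>k\<close> on the right.\<close>

definition mat_trace :: "complex mat \<Rightarrow> complex" where
  "mat_trace A = (\<Sum>i<dim_row A. A $$ (i, i))"

definition kron :: "complex mat \<Rightarrow> complex mat \<Rightarrow> complex mat" where
  "kron A B = mat (dim_row A * dim_row B) (dim_col A * dim_col B)
     (\<lambda>(i, j). A $$ (i div dim_row B, j div dim_col B) * B $$ (i mod dim_row B, j mod dim_col B))"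

text \<open>The order on \<^typ>\<open>complex\<close> is the one of \<^theory>\<open>HOL-Library.Complex_Order\<close>:
  \<open>0 \<le> c\<close> says that \<open>c\<close> is real and nonnegative. Hence the condition below forces \<open>A\<close> to be
  Hermitian.\<close>

definition psd :: "nat \<Rightarrow> complex mat \<Rightarrow> bool" where
  "psd n A \<longleftrightarrow> A \<in> carrier_mat n n \<and> (\<forall>v\<in>carrier_vec n. 0 \<le> (A *\<^sub>v v) \<bullet>c v)"

definition unitary_mat :: "nat \<Rightarrow> complex mat \<Rightarrow> bool" where
  "unitary_mat n U \<longleftrightarrow> U \<in> carrier_mat n n \<and>
     mat_adjoint U * U = 1\<^sub>m n \<and> U * mat_adjoint U = 1\<^sub>m n"

definition state :: "nat \<Rightarrow> complex mat \<Rightarrow> bool" where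
  "state n \<rho> \<longleftrightarrow> psd n \<rho> \<and> mat_trace \<rho> = 1"

definition povm :: "nat \<Rightarrow> 'o set \<Rightarrow> ('o \<Rightarrow> complex mat) \<Rightarrow> bool" where
  "povm n A M \<longleftrightarrow> (\<forall>a\<in>A. psd n (M a)) \<and>
     (\<forall>i<n. \<forall>j<n. (\<Sum>a\<in>A. M a $$ (i, j)) = 1\<^sub>m n $$ (i, j))"

definition mat_elem :: "nat \<Rightarrow> nat \<Rightarrow> nat \<Rightarrow> complex mat" where
  "mat_elem n i j = mat n n (\<lambda>(r, s). if r = i \<and> s = j then 1 else 0)"

text \<open>The tensor product of a linear map \<open>E\<close> from \<open>nA \<times> nA\<close> to \<open>mA \<times> mA\<close> matrices and a
  linear map \<open>F\<close> from \<open>nB \<times> nB\<close> to \<open>mB \<times> mB\<close> matrices, obtained by expanding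
  the argument in the basis of products of matrix units.\<close>

definition map_tensor ::
    "nat \<Rightarrow> nat \<Rightarrow> nat \<Rightarrow> nat \<Rightarrow> (complex mat \<Rightarrow> complex mat) \<Rightarrow> (complex mat \<Rightarrow> complex mat)
       \<Rightarrow> complex mat \<Rightarrow> complex mat" where
  "map_tensor nA mA nB mB E F \<rho> = mat (mA * mB) (mA * mB) (\<lambda>(r, s).
     \<Sum>i<nA. \<Sum>j<nA. \<Sum>k<nB. \<Sum>l<nB.
       \<rho> $$ (i * nB + k, j * nB + l) * kron (E (mat_elem nA i j)) (F (mat_elem nB k l)) $$ (r, s))"

definition linear_map :: "nat \<Rightarrow> nat \<Rightarrow> (complex mat \<Rightarrow> complex mat) \<Rightarrow> bool" where
  "linear_map n m E \<longleftrightarrow>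
     (\<forall>A\<in>carrier_mat n n. E A \<in> carrier_mat m m) \<and>
     (\<forall>A\<in>carrier_mat n n. \<forall>B\<in>carrier_mat n n. E (A + B) = E A + E B) \<and>
     (\<forall>c. \<forall>A\<in>carrier_mat n n. E (c \<cdot>\<^sub>m A) = c \<cdot>\<^sub>m E A)"

definition completely_positive :: "nat \<Rightarrow> nat \<Rightarrow> (complex mat \<Rightarrow> complex mat) \<Rightarrow> bool" where
  "completely_positive n m E \<longleftrightarrow>
     (\<forall>k A. psd (k * n) A \<longrightarrow> psd (k * m) (map_tensor k k n m (\<lambda>B. B) E A))"

definition channel :: "nat \<Rightarrow> nat \<Rightarrow> (complex mat \<Rightarrow> complex mat) \<Rightarrow> bool" where
  "channel n m E \<longleftrightarrow> linear_map n m E \<and> completely_positive n m E \<and>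
     (\<forall>A\<in>carrier_mat n n. mat_trace (E A) = mat_trace A)"

definition tnc :: "nat \<Rightarrow> ('g, 'm) monoid_scheme \<Rightarrow> bool" where
  "tnc d G \<longleftrightarrow> group G \<and> card (carrier G) = d\<^sup>2 \<and>
     (\<exists>U (\<omega> :: 'g \<Rightarrow> 'g \<Rightarrow> complex).
        (\<forall>g\<in>carrier G. unitary_mat d (U g)) \<and>
        (\<forall>g\<in>carrier G. \<forall>h\<in>carrier G.
           mat_trace (mat_adjoint (U g) * U h) = (if g = h then of_nat d else 0)) \<and>
        (\<forall>g\<in>carrier G. \<forall>h\<in>carrier G.
           cmod (\<omega> g h) = 1 \<and> U g * U h = \<omega> g h \<cdot>\<^sub>m U (g \<otimes>\<^bsub>G\<^esub> h)))"

section \<open>Sets of conditional distributions\<close>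

text \<open>A conditional distribution \<open>Q(z|x,y)\<close> is written \<open>Q x y z\<close>, and similarly for the others.
  Only its values on the alphabets matter; elsewhere it is unconstrained.\<close>

definition prob_dist :: "'a set \<Rightarrow> ('a \<Rightarrow> real) \<Rightarrow> bool" where
  "prob_dist A p \<longleftrightarrow> (\<forall>a\<in>A. 0 \<le> p a) \<and> (\<Sum>a\<in>A. p a) = 1"

definition C_set :: "'x set \<Rightarrow> 'y set \<Rightarrow> 'z set \<Rightarrow> nat \<Rightarrow> nat \<Rightarrow> ('x \<Rightarrow> 'y \<Rightarrow> 'z \<Rightarrow> real) set" where
  "C_set X Y Z d1 d2 = {Q. \<exists>P1 P2 R.
     (\<forall>x\<in>X. prob_dist {..<d1} (P1 x)) \<and> (\<forall>y\<in>Y. prob_dist {..<d2} (P2 y)) \<and>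
     (\<forall>a<d1. \<forall>b<d2. prob_dist Z (R a b)) \<and>
     (\<forall>x\<in>X. \<forall>y\<in>Y. \<forall>z\<in>Z. Q x y z = (\<Sum>a<d1. \<Sum>b<d2. R a b z * P1 x a * P2 y b))}"

definition nonsignaling ::
    "'x set \<Rightarrow> 'y set \<Rightarrow> nat \<Rightarrow> nat \<Rightarrow> ('x \<Rightarrow> 'y \<Rightarrow> nat \<Rightarrow> nat \<Rightarrow> real) \<Rightarrow> bool" where
  "nonsignaling X Y d1 d2 N \<longleftrightarrow>
     (\<forall>x\<in>X. \<forall>y\<in>Y. prob_dist ({..<d1} \<times> {..<d2}) (\<lambda>(a, b). N x y a b)) \<and>
     (\<forall>x\<in>X. \<forall>y\<in>Y. \<forall>y'\<in>Y. \<forall>a<d1. (\<Sum>b<d2. N x y a b) = (\<Sum>b<d2. N x y' a b)) \<and>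
     (\<forall>x\<in>X. \<forall>x'\<in>X. \<forall>y\<in>Y. \<forall>b<d2. (\<Sum>a<d1. N x y a b) = (\<Sum>a<d1. N x' y a b))"

definition entangled ::
    "'x set \<Rightarrow> 'y set \<Rightarrow> nat \<Rightarrow> nat \<Rightarrow> ('x \<Rightarrow> 'y \<Rightarrow> nat \<Rightarrow> nat \<Rightarrow> real) \<Rightarrow> bool" where
  "entangled X Y d1 d2 N \<longleftrightarrow> (\<exists>nA nB \<rho> M L.
     state (nA * nB) \<rho> \<and>
     (\<forall>x\<in>X. povm nA {..<d1} (M x)) \<and> (\<forall>y\<in>Y. povm nB {..<d2} (L y)) \<and>
     (\<forall>x\<in>X. \<forall>y\<in>Y. \<forall>a<d1. \<forall>b<d2.
        complex_of_real (N x y a b) = mat_trace (kron (M x a) (L y b) * \<rho>)))"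

definition decoded ::
    "'x set \<Rightarrow> 'y set \<Rightarrow> 'z set \<Rightarrow> nat \<Rightarrow> nat \<Rightarrow> ('x \<Rightarrow> 'y \<Rightarrow> nat \<Rightarrow> nat \<Rightarrow> real)
       \<Rightarrow> ('x \<Rightarrow> 'y \<Rightarrow> 'z \<Rightarrow> real) set" where
  "decoded X Y Z d1 d2 N = {Q. \<exists>R.
     (\<forall>a<d1. \<forall>b<d2. prob_dist Z (R a b)) \<and>
     (\<forall>x\<in>X. \<forall>y\<in>Y. \<forall>z\<in>Z. Q x y z = (\<Sum>a<d1. \<Sum>b<d2. R a b z * N x y a b))}"

definition CN_set :: "'x set \<Rightarrow> 'y set \<Rightarrow> 'z set \<Rightarrow> nat \<Rightarrow> nat \<Rightarrow> ('x \<Rightarrow> 'y \<Rightarrow> 'z \<Rightarrow> real) set" where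
  "CN_set X Y Z d1 d2 = {Q. \<exists>N. nonsignaling X Y d1 d2 N \<and> Q \<in> decoded X Y Z d1 d2 N}"

definition CE_set :: "'x set \<Rightarrow> 'y set \<Rightarrow> 'z set \<Rightarrow> nat \<Rightarrow> nat \<Rightarrow> ('x \<Rightarrow> 'y \<Rightarrow> 'z \<Rightarrow> real) set" where
  "CE_set X Y Z d1 d2 = {Q. \<exists>N. entangled X Y d1 d2 N \<and> Q \<in> decoded X Y Z d1 d2 N}"

definition Q_set :: "'x set \<Rightarrow> 'y set \<Rightarrow> 'z set \<Rightarrow> nat \<Rightarrow> nat \<Rightarrow> ('x \<Rightarrow> 'y \<Rightarrow> 'z \<Rightarrow> real) set" where
  "Q_set X Y Z d1 d2 = {Q. \<exists>\<rho> \<sigma> T.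
     (\<forall>x\<in>X. state d1 (\<rho> x)) \<and> (\<forall>y\<in>Y. state d2 (\<sigma> y)) \<and> povm (d1 * d2) Z T \<and>
     (\<forall>x\<in>X. \<forall>y\<in>Y. \<forall>z\<in>Z.
        complex_of_real (Q x y z) = mat_trace (T z * kron (\<rho> x) (\<sigma> y)))}"

definition QE_set :: "'x set \<Rightarrow> 'y set \<Rightarrow> 'z set \<Rightarrow> nat \<Rightarrow> nat \<Rightarrow> ('x \<Rightarrow> 'y \<Rightarrow> 'z \<Rightarrow> real) set" where
  "QE_set X Y Z d1 d2 = {Q. \<exists>nA nB \<rho> E F T.
     state (nA * nB) \<rho> \<and>
     (\<forall>x\<in>X. channel nA d1 (E x)) \<and> (\<forall>y\<in>Y. channel nB d2 (F y)) \<and> povm (d1 * d2) Z T \<and>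
     (\<forall>x\<in>X. \<forall>y\<in>Y. \<forall>z\<in>Z.
        complex_of_real (Q x y z) = mat_trace (T z * map_tensor nA d1 nB d2 (E x) (F y) \<rho>))}"

section \<open>Success probability\<close>

definition succ_prob :: "'x set \<Rightarrow> 'y set \<Rightarrow> ('x \<Rightarrow> 'y \<Rightarrow> 'z) \<Rightarrow> ('x \<Rightarrow> 'y \<Rightarrow> 'z \<Rightarrow> real) \<Rightarrow> real" where
  "succ_prob X Y f Q = (\<Sum>x\<in>X. \<Sum>y\<in>Y. Q x y (f x y)) / (real (card X) * real (card Y))"

text \<open>The supremum is taken in \<^typ>\<open>real\<close>. It is meaningful for the sets above when
  the alphabets and the dimensions are nonempty and positive: those sets are then nonempty, and the
  success probabilities lie between 0 and 1.\<close>

definition succ_sup ::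
    "'x set \<Rightarrow> 'y set \<Rightarrow> ('x \<Rightarrow> 'y \<Rightarrow> 'z) \<Rightarrow> ('x \<Rightarrow> 'y \<Rightarrow> 'z \<Rightarrow> real) set \<Rightarrow> real" where
  "succ_sup X Y f S = (SUP Q\<in>S. succ_prob X Y f Q)"

end

theory Submission
  imports Defs "HOL-Analysis.Convex" "HOL-Number_Theory.Cong"
begin

text \<open>For the upper bounds, fix \<open>y\<close>: a nonsignaling box satisfies \<open>N(a,b|x,y) \<le> N(b|y)\<close>, and a state
  satisfies \<open>\<rho> \<le> 1\<close>, so that \<open>Q(z|x,y)\<close> is bounded independently of \<open>x\<close> by a nonnegative function of
  \<open>z\<close> with total weight \<open>d1\<close>. As \<open>x\<close> varies, \<open>f x y\<close> takes each value once, which gives \<open>d1 / d\<^sup>2\<close>;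
  exchanging the roles of \<open>x\<close> and \<open>y\<close> gives \<open>d2 / d\<^sup>2\<close>. With entanglement, dense coding on a maximally
  entangled state of local dimension \<open>d\<close> transmits the product of the two group elements perfectly.
  For addition modulo \<open>d\<close>, both parties send the number of the block containing each
  coordinate, and the decoder guesses the most likely sum.\<close>

unbundle no inner_syntax

text \<open>The entangled quantum value takes more work than the other four. Its supremum is one in
  the reals, so a perfect protocol settles nothing until the success probabilities are known to be
  bounded, for arbitrary channels and an arbitrary shared state. Complete positivity speaks of one
  map next to an identity, whereas here two maps act side by side; Kraus operators close this gap.
  This is why positivity is handled through Gram vectors: tensor products and channels act on them
  directly. The inclusions of C in CE, of CE in CN and of C in Q spread two upper bounds over four
  sets, and let one classical strategy give equality in all of them. Its constant comes from two
  independent uniform residues below \<open>m\<close>: their sum is \<open>m - 1\<close> with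
  probability \<open>1 / m\<close>, so block lengths \<open>d / d1'\<close> and
  \<open>d / d2'\<close> give \<open>d1' * d2' / d\<^sup>2\<close>. Dense coding is formulated for
  bare families of matrices, so that it serves both a TNC group identified with three alphabets and
  the Pauli operators on \<open>Zd2 d\<close>.\<close>

lemma nonneg_complex_iff: "0 \<le> (c::complex) \<longleftrightarrow> 0 \<le> Re c \<and> Im c = 0"
  by (auto simp: less_eq_complex_def)

lemma mult_cnj_nonneg: "0 \<le> (z::complex) * cnj z"
  by (simp add: nonneg_complex_iff complex_mult_cnj)

subsection \<open>Index arithmetic\<close>

lemma sum_rotate:
  "(\<Sum>i\<in>I. \<Sum>j\<in>J. \<Sum>p\<in>P. g i j p) = (\<Sum>p\<in>P. \<Sum>i\<in>I. \<Sum>j\<in>J. g i j p)"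
proof -
  have "(\<Sum>i\<in>I. \<Sum>j\<in>J. \<Sum>p\<in>P. g i j p) = (\<Sum>i\<in>I. \<Sum>p\<in>P. \<Sum>j\<in>J. g i j p)"
    by (intro sum.cong refl sum.swap)
  also have "\<dots> = (\<Sum>p\<in>P. \<Sum>i\<in>I. \<Sum>j\<in>J. g i j p)"
    by (rule sum.swap)
  finally show ?thesis .
qed

lemma sum_lessThan_mult:
  fixes g :: "nat \<Rightarrow> 'a::comm_monoid_add"
  shows "(\<Sum>p<m * n. g p) = (\<Sum>i<m. \<Sum>k<n. g (i * n + k))"
proof -
  have shift: "sum g {k..<k + n} = (\<Sum>l<n. g (k + l))" for k
    using sum.shift_bounds_nat_ivl[of g 0 k n] by (simp add: atLeast0LessThan add.commute)
  have "(\<Sum>p<m * n. g p) = (\<Sum>i<m. sum g {i * n..<i * n + n})"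
    by (simp add: sum.nat_group)
  then show ?thesis
    by (simp only: shift)
qed

lemma pair_index_less: "i < m \<Longrightarrow> k < n \<Longrightarrow> i * n + k < m * (n::nat)"
proof -
  assume "i < m" "k < n"
  then have "i * n + k < Suc i * n" "Suc i * n \<le> m * n"
    by (simp, intro mult_le_mono1, simp)
  then show ?thesis by linarith
qed

lemma kron_carrier:
  "A \<in> carrier_mat m m \<Longrightarrow> B \<in> carrier_mat n n \<Longrightarrow> kron A B \<in> carrier_mat (m * n) (m * n)"
  by (simp add: kron_def)

lemma kron_index:
  "A \<in> carrier_mat m m \<Longrightarrow> B \<in> carrier_mat n n \<Longrightarrow> p < m * n \<Longrightarrow> q < m * n \<Longrightarrow>
   kron A B $$ (p, q) = A $$ (p div n, q div n) * B $$ (p mod n, q mod n)"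
  by (auto simp: kron_def)

lemma kron_pair_index:
  "A \<in> carrier_mat m m \<Longrightarrow> B \<in> carrier_mat n n \<Longrightarrow> i < m \<Longrightarrow> j < m \<Longrightarrow> k < n \<Longrightarrow> l < n \<Longrightarrow>
   kron A B $$ (i * n + k, j * n + l) = A $$ (i, j) * B $$ (k, l)"
  by (subst kron_index[where m = m and n = n]) (auto intro: pair_index_less)

lemma mat_trace_mult:
  "A \<in> carrier_mat n n \<Longrightarrow> B \<in> carrier_mat n n \<Longrightarrow>
   mat_trace (A * B) = (\<Sum>i<n. \<Sum>j<n. A $$ (i, j) * B $$ (j, i))"
  by (auto simp: mat_trace_def scalar_prod_def atLeast0LessThan intro!: sum.cong)

lemma quad_form_eq:
  "A \<in> carrier_mat n n \<Longrightarrow> v \<in> carrier_vec n \<Longrightarrow>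
   (A *\<^sub>v v) \<bullet>c v = (\<Sum>i<n. \<Sum>j<n. A $$ (i, j) * v $ j * cnj (v $ i))"
  by (auto simp: scalar_prod_def atLeast0LessThan sum_distrib_right intro!: sum.cong)

subsection \<open>Positive semidefinite matrices are Gram matrices\<close>

lemma psd_carrier: "psd n A \<Longrightarrow> A \<in> carrier_mat n n"
  by (simp add: psd_def)

lemma psd_quad_form_nonneg:
  assumes "psd n A"
  shows "0 \<le> (\<Sum>i<n. \<Sum>j<n. A $$ (i, j) * v j * cnj (v i))"
proof -
  have "0 \<le> (A *\<^sub>v vec n v) \<bullet>c vec n v"
    using assms unfolding psd_def by (metis vec_carrier)
  also have "(A *\<^sub>v vec n v) \<bullet>c vec n v = (\<Sum>i<n. \<Sum>j<n. A $$ (i, j) * v j * cnj (v i))"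
    using assms by (subst quad_form_eq[where n = n]) (auto simp: psd_def)
  finally show ?thesis .
qed

lemma psdI:
  assumes "A \<in> carrier_mat n n"
    and "\<And>v. 0 \<le> (\<Sum>i<n. \<Sum>j<n. A $$ (i, j) * v j * cnj (v i))"
  shows "psd n A"
  using assms unfolding psd_def by (auto simp: quad_form_eq)

text \<open>The form at \<open>v\<close> is the sum over \<open>p\<close> of the squared moduli of
  \<open>\<Sum>i<n. B p i * cnj (v i)\<close>. The index set \<open>P\<close> is left free: a point
  for rank one, pairs for tensor products, triples for channels.\<close>

lemma psd_gramI:
  assumes A: "A \<in> carrier_mat n n"
    and gram: "\<And>i j. i < n \<Longrightarrow> j < n \<Longrightarrow> A $$ (i, j) = (\<Sum>p\<in>P. B p i * cnj (B p j))"
  shows "psd n A"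
proof (rule psdI[OF A])
  fix v :: "nat \<Rightarrow> complex"
  have "(\<Sum>i<n. \<Sum>j<n. A $$ (i, j) * v j * cnj (v i))
      = (\<Sum>i<n. \<Sum>j<n. \<Sum>p\<in>P. (B p i * cnj (v i)) * cnj (B p j * cnj (v j)))"
    by (auto simp: gram sum_distrib_right sum_distrib_left mult_ac intro!: sum.cong)
  also have "\<dots> = (\<Sum>p\<in>P. (\<Sum>i<n. B p i * cnj (v i)) * cnj (\<Sum>j<n. B p j * cnj (v j)))"
    unfolding cnj_sum sum_product by (rule sum_rotate)
  finally show "0 \<le> (\<Sum>i<n. \<Sum>j<n. A $$ (i, j) * v j * cnj (v i))"
    by (simp only: sum_nonneg mult_cnj_nonneg)
qed

text \<open>Evaluates the form on a vector supported at two indices; suitable \<open>x\<close> and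
  \<open>y\<close> then give the information on off-diagonal entries.\<close>

lemma psd_form_two_points:
  fixes A :: "nat \<Rightarrow> nat \<Rightarrow> complex"
  assumes form: "\<And>v. 0 \<le> (\<Sum>i<n. \<Sum>j<n. A i j * v j * cnj (v i))"
    and ij: "i < n" "j < n" "i \<noteq> j"
  shows "0 \<le> A i i * x * cnj x + A i j * y * cnj x + A j i * x * cnj y + A j j * y * cnj y"
proof -
  define v where "v k = (if k = i then x else 0) + (if k = j then y else 0)" for k
  have 1: "(\<Sum>l<n. A k l * v l * c) = (A k i * x + A k j * y) * c" for k c
  proof -
    have "(\<Sum>l<n. A k l * v l * c)
        = (\<Sum>l<n. (if l = i then A k i * x * c else 0) + (if l = j then A k j * y * c else 0))"
      by (intro sum.cong refl) (auto simp: v_def algebra_simps)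
    then show ?thesis
      using ij by (simp add: sum.distrib algebra_simps)
  qed
  have "(\<Sum>k<n. \<Sum>l<n. A k l * v l * cnj (v k))
      = (\<Sum>k<n. (if k = i then (A i i * x + A i j * y) * cnj x else 0)
             + (if k = j then (A j i * x + A j j * y) * cnj y else 0))"
    unfolding 1 using ij by (intro sum.cong refl) (auto simp: v_def)
  also have "\<dots> = A i i * x * cnj x + A i j * y * cnj x + A j i * x * cnj y + A j j * y * cnj y"
    using ij by (simp add: sum.distrib algebra_simps)
  finally show ?thesis
    using form[of v] by simp
qed

lemma psd_form_hermitian:
  fixes A :: "nat \<Rightarrow> nat \<Rightarrow> complex"
  assumes form: "\<And>v. 0 \<le> (\<Sum>i<n. \<Sum>j<n. A i j * v j * cnj (v i))"
    and ij: "i < n" "j < n" "i \<noteq> j"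
  shows "0 \<le> A i i" "A j i = cnj (A i j)"
proof -
  note two = psd_form_two_points[where A = A and n = n, OF form ij]
  show 0: "0 \<le> A i i"
    using two[of 1 0] by simp
  have 1: "0 \<le> A j j"
    using two[of 0 1] by simp
  \<comment> \<open>At \<open>(1, 1)\<close> reality makes the imaginary parts of
    \<open>A i j\<close> and \<open>A j i\<close> cancel, at \<open>(1, \<i>)\<close> it makes their
    real parts agree.\<close>
  show "A j i = cnj (A i j)"
    using two[of 1 1] two[of 1 \<i>] 0 1 by (auto simp: nonneg_complex_iff complex_eq_iff)
qed

text \<open>With \<open>A j j = 0\<close> the two-point form is real affine in the second
  coordinate, hence unbounded below unless the cross terms vanish.\<close>

lemma psd_form_diag_zero:
  fixes A :: "nat \<Rightarrow> nat \<Rightarrow> complex"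
  assumes form: "\<And>v. 0 \<le> (\<Sum>i<n. \<Sum>j<n. A i j * v j * cnj (v i))"
    and ij: "i < n" "j < n" "A j j = 0"
  shows "A i j = 0"
proof (rule ccontr)
  assume ne: "A i j \<noteq> 0"
  with ij have "i \<noteq> j" by auto
  note ij = ij(1,2) this
  \<comment> \<open>Each cross term becomes \<open>- r\<close>, so the form takes the value
    \<open>- A i i - 2\<close>, which is negative; the summand 1 covers
    \<open>A i i = 0\<close>.\<close>
  define r where "r = complex_of_real (Re (A i i) + 1)"
  have "A i j * (- r / A i j) = - r" "A j i * cnj (- r / A i j) = - r"
    using ne psd_form_hermitian(2)[where A = A and n = n, OF form ij] by (auto simp: r_def)
  then have "0 \<le> A i i + - r + - r"
    using psd_form_two_points[where A = A and n = n, OF form ij, of 1 "- r / A i j"] assms(4) by simp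
  then show False
    using psd_form_hermitian(1)[where A = A and n = n, OF form ij] by (simp add: nonneg_complex_iff r_def)
qed

text \<open>Cholesky factorisation: the last row is split off and the rest is replaced by its Schur
  complement. If the last diagonal entry vanishes, so does its column, and the formulas remain valid
  with \<open>x / 0 = 0\<close>.\<close>

lemma psd_form_gram:
  fixes A :: "nat \<Rightarrow> nat \<Rightarrow> complex"
  assumes "\<And>v. 0 \<le> (\<Sum>i<n. \<Sum>j<n. A i j * v j * cnj (v i))"
  shows "\<exists>B. \<forall>i<n. \<forall>j<n. A i j = (\<Sum>p<n. B p i * cnj (B p j))"
  using assms
proof (induction n arbitrary: A)
  case 0
  then show ?case by simp
next
  case (Suc n)
  note form = Suc.prems
  define a where "a = A n n"
  define A' where "A' i j = A i j - A i n * A n j / a" for i j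
  have a: "0 \<le> a"
    using form[of "\<lambda>k. if k = n then 1 else 0"] by (simp add: a_def)
  have herm: "A n j = cnj (A j n)" if "j < n" for j
    using psd_form_hermitian(2)[where A = A and n = "Suc n" and i = j and j = n, OF form] that by simp
  have zero: "A i n = 0" if "i < n" "a = 0" for i
    using psd_form_diag_zero[where A = A and n = "Suc n" and i = i and j = n, OF form] that by (simp add: a_def)
  have "0 \<le> (\<Sum>i<n. \<Sum>j<n. A' i j * v j * cnj (v i))" for v
  proof -
    define S where "S = (\<Sum>j<n. A n j * v j)"
    \<comment> \<open>The last coordinate that completes the square: row \<open>n\<close>
      contributes \<open>cnj w * (S + a * w) = 0\<close>, and the form of the Schur complement
      remains. For \<open>a = 0\<close> the division yields \<open>w = 0\<close>.\<close>
    define w where "w = - S / a"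
    define v' where "v' = v(n := w)"
    have kill: "cnj w * (S + a * w) = 0"
      by (cases "a = 0") (auto simp: w_def)
    have "(\<Sum>i<Suc n. \<Sum>j<Suc n. A i j * v' j * cnj (v' i))
        = (\<Sum>i<n. (\<Sum>j<n. A i j * v j * cnj (v i)) + A i n * w * cnj (v i))
          + ((\<Sum>j<n. A n j * v j * cnj w) + a * w * cnj w)"
      by (simp add: v'_def a_def)
    also have "(\<Sum>j<n. A n j * v j * cnj w) + a * w * cnj w = cnj w * (S + a * w)"
      by (simp add: S_def sum_distrib_left algebra_simps)
    also have "(\<Sum>i<n. (\<Sum>j<n. A i j * v j * cnj (v i)) + A i n * w * cnj (v i))
        = (\<Sum>i<n. \<Sum>j<n. A' i j * v j * cnj (v i))"
    proof (intro sum.cong refl)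
      fix i
      have "A i n * w * cnj (v i) = (\<Sum>j<n. - (A i n * A n j / a) * v j * cnj (v i))"
        by (simp add: w_def S_def sum_distrib_left sum_distrib_right sum_divide_distrib
            sum_negf mult_ac)
      then show "(\<Sum>j<n. A i j * v j * cnj (v i)) + A i n * w * cnj (v i)
          = (\<Sum>j<n. A' i j * v j * cnj (v i))"
        by (simp add: A'_def sum.distrib[symmetric] algebra_simps)
    qed
    finally show ?thesis
      using form[of v'] by (simp add: kill)
  qed
  from Suc.IH[OF this] obtain B' where
    B': "\<And>i j. i < n \<Longrightarrow> j < n \<Longrightarrow> A' i j = (\<Sum>p<n. B' p i * cnj (B' p j))"
    by blast
  define s where "s = complex_of_real (sqrt (Re a))"
  have s: "s * s = a" "cnj s = s"
    using a by (auto simp: s_def nonneg_complex_iff complex_eq_iff)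
  \<comment> \<open>The new factor \<open>p = n\<close> is the last column scaled by
    \<open>1 / s\<close>; the old factors are extended by 0 at index \<open>n\<close>.\<close>
  define B where "B p i = (if p < n then if i < n then B' p i else 0 else A i n / s)" for p i
  have "A i j = (\<Sum>p<Suc n. B p i * cnj (B p j))" if ij: "i < Suc n" "j < Suc n" for i j
  proof -
    consider "i < n" "j < n" | "i = n" "j < n" | "i < n" "j = n" | "i = n" "j = n"
      using ij by (auto simp: less_Suc_eq)
    then show ?thesis
    proof cases
      case 1
      then have "(\<Sum>p<Suc n. B p i * cnj (B p j)) = A' i j + A i n * A n j / (s * s)"
        by (simp add: B_def B' herm s(2))
      then show ?thesis
        by (simp add: A'_def s(1))
    next
      case 2
      then have "(\<Sum>p<Suc n. B p i * cnj (B p j)) = a * A n j / (s * s)"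
        by (simp add: B_def herm s(2) a_def)
      then show ?thesis
        using 2 zero[of j] herm[of j] by (cases "a = 0") (auto simp: s(1))
    next
      case 3
      then have "(\<Sum>p<Suc n. B p i * cnj (B p j)) = A i n * cnj a / (s * s)"
        by (simp add: B_def s(2) a_def)
      moreover have "cnj a = a"
        using a by (simp add: nonneg_complex_iff complex_eq_iff)
      ultimately show ?thesis
        using 3 zero[of i] by (cases "a = 0") (auto simp: s(1))
    next
      case 4
      then have "(\<Sum>p<Suc n. B p i * cnj (B p j)) = a * cnj a / (s * s)"
        by (simp add: B_def s(2) a_def)
      moreover have "cnj a = a"
        using a by (simp add: nonneg_complex_iff complex_eq_iff)
      ultimately show ?thesis
        using 4 by (cases "a = 0") (auto simp: s(1) a_def)
    qed
  qed
  then show ?case by blast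
qed

lemma psd_gramE:
  assumes "psd n A"
  obtains B where "\<And>i j. i < n \<Longrightarrow> j < n \<Longrightarrow> A $$ (i, j) = (\<Sum>p<n. B p i * cnj (B p j))"
  using psd_form_gram[of "\<lambda>i j. A $$ (i, j)" n, OF psd_quad_form_nonneg[OF assms]] by blast

section \<open>Trace pairings, tensor products and states\<close>

lemma Cauchy_Schwarz_complex:
  fixes a b :: "'a \<Rightarrow> complex"
  shows "(cmod (\<Sum>i\<in>I. a i * b i))\<^sup>2 \<le> (\<Sum>i\<in>I. (cmod (a i))\<^sup>2) * (\<Sum>i\<in>I. (cmod (b i))\<^sup>2)"
proof -
  have "(cmod (\<Sum>i\<in>I. a i * b i))\<^sup>2 \<le> (\<Sum>i\<in>I. cmod (a i) * cmod (b i))\<^sup>2"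
    by (intro power_mono) (auto intro: order_trans[OF norm_sum] simp: norm_mult)
  also have "\<dots> \<le> (\<Sum>i\<in>I. (cmod (a i))\<^sup>2) * (\<Sum>i\<in>I. (cmod (b i))\<^sup>2)"
    by (rule Cauchy_Schwarz_ineq_sum)
  finally show ?thesis .
qed

text \<open>Expanding \<open>B\<close> into Gram vectors turns the trace into a sum of quadratic
  forms of \<open>A\<close>. This is what makes outcome probabilities real and nonnegative.\<close>

lemma trace_psd_mult_nonneg:
  assumes A: "psd n A" and B: "psd n B"
  shows "0 \<le> mat_trace (A * B)"
proof -
  obtain b where b: "\<And>i j. i < n \<Longrightarrow> j < n \<Longrightarrow> B $$ (i, j) = (\<Sum>p<n. b p i * cnj (b p j))"
    using psd_gramE[OF B] by blast
  have "mat_trace (A * B) = (\<Sum>i<n. \<Sum>j<n. A $$ (i, j) * B $$ (j, i))"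
    using A B by (intro mat_trace_mult psd_carrier)
  also have "\<dots> = (\<Sum>i<n. \<Sum>j<n. \<Sum>p<n. A $$ (i, j) * b p j * cnj (b p i))"
    by (auto simp: b sum_distrib_left mult_ac intro!: sum.cong)
  also have "\<dots> = (\<Sum>p<n. \<Sum>i<n. \<Sum>j<n. A $$ (i, j) * b p j * cnj (b p i))"
    by (rule sum_rotate)
  finally show ?thesis
    by (simp only: sum_nonneg psd_quad_form_nonneg[OF A])
qed

text \<open>Products of Gram vectors of the factors are Gram vectors of the tensor product.\<close>

lemma psd_kron:
  assumes A: "psd m A" and B: "psd n B"
  shows "psd (m * n) (kron A B)"
proof -
  obtain a where a: "\<And>i j. i < m \<Longrightarrow> j < m \<Longrightarrow> A $$ (i, j) = (\<Sum>p<m. a p i * cnj (a p j))"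
    using psd_gramE[OF A] by blast
  obtain b where b: "\<And>i j. i < n \<Longrightarrow> j < n \<Longrightarrow> B $$ (i, j) = (\<Sum>p<n. b p i * cnj (b p j))"
    using psd_gramE[OF B] by blast
  note car = psd_carrier[OF A] psd_carrier[OF B]
  show ?thesis
  proof (rule psd_gramI[where P = "{..<m} \<times> {..<n}"
        and B = "\<lambda>(p, q) i. a p (i div n) * b q (i mod n)"])
    show "kron A B \<in> carrier_mat (m * n) (m * n)"
      using car by (rule kron_carrier)
    fix i j assume ij: "i < m * n" "j < m * n"
    then have "0 < n" by (cases n) auto
    with ij have "i div n < m" "j div n < m" "i mod n < n" "j mod n < n"
      by (auto simp: less_mult_imp_div_less)
    then show "kron A B $$ (i, j) = (\<Sum>p\<in>{..<m} \<times> {..<n}.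
        (case p of (p, q) \<Rightarrow> \<lambda>i. a p (i div n) * b q (i mod n)) i *
        cnj ((case p of (p, q) \<Rightarrow> \<lambda>i. a p (i div n) * b q (i mod n)) j))"
      by (subst kron_index[OF car ij])
        (simp add: a b sum_product sum.cartesian_product case_prod_beta mult_ac)
  qed
qed

text \<open>The squared norms of the Gram vectors add up to the trace, which is 1; Cauchy-Schwarz
  for each of them bounds the form of \<open>\<rho>\<close> at \<open>v\<close> by the squared norm
  of \<open>v\<close>.\<close>

lemma psd_one_minus_state:
  assumes "state n \<rho>"
  shows "psd n (1\<^sub>m n - \<rho>)"
proof -
  have \<rho>: "psd n \<rho>" and tr: "mat_trace \<rho> = 1"
    using assms by (auto simp: state_def)
  note car = psd_carrier[OF \<rho>]
  obtain b where b: "\<And>i j. i < n \<Longrightarrow> j < n \<Longrightarrow> \<rho> $$ (i, j) = (\<Sum>p<n. b p i * cnj (b p j))"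
    using psd_gramE[OF \<rho>] by blast
  have "complex_of_real (\<Sum>p<n. \<Sum>i<n. (cmod (b p i))\<^sup>2) = (\<Sum>i<n. \<Sum>p<n. b p i * cnj (b p i))"
    unfolding of_real_sum complex_norm_square by (rule sum.swap)
  also have "\<dots> = mat_trace \<rho>"
    using car by (auto simp: mat_trace_def b)
  finally have bsum: "(\<Sum>p<n. \<Sum>i<n. (cmod (b p i))\<^sup>2) = 1"
    unfolding tr by (simp only: of_real_eq_1_iff)
  show ?thesis
  proof (rule psdI)
    show "1\<^sub>m n - \<rho> \<in> carrier_mat n n"
      using car by auto
    fix v :: "nat \<Rightarrow> complex"
    define c where "c p = (\<Sum>i<n. b p i * cnj (v i))" for p
    define V where "V = (\<Sum>i<n. (cmod (v i))\<^sup>2)"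
    have "(\<Sum>p<n. (cmod (c p))\<^sup>2) \<le> (\<Sum>p<n. (\<Sum>i<n. (cmod (b p i))\<^sup>2) * (\<Sum>i<n. (cmod (cnj (v i)))\<^sup>2))"
      unfolding c_def by (intro sum_mono Cauchy_Schwarz_complex)
    also have "\<dots> = V"
      by (simp add: sum_distrib_right[symmetric] bsum V_def)
    finally have le: "(\<Sum>p<n. (cmod (c p))\<^sup>2) \<le> V" .
    have "(\<Sum>i<n. \<Sum>j<n. (1\<^sub>m n - \<rho>) $$ (i, j) * v j * cnj (v i))
        = (\<Sum>i<n. \<Sum>j<n. (if i = j then v j * cnj (v i) else 0)) -
          (\<Sum>i<n. \<Sum>j<n. \<rho> $$ (i, j) * v j * cnj (v i))"
      unfolding sum_subtractf[symmetric] using car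
      by (intro sum.cong refl) (auto simp: algebra_simps)
    also have "(\<Sum>i<n. \<Sum>j<n. (if i = j then v j * cnj (v i) else 0)) = complex_of_real V"
      unfolding V_def of_real_sum complex_norm_square by (intro sum.cong refl) simp
    also have "(\<Sum>i<n. \<Sum>j<n. \<rho> $$ (i, j) * v j * cnj (v i))
        = (\<Sum>i<n. \<Sum>j<n. \<Sum>p<n. (b p i * cnj (v i)) * cnj (b p j * cnj (v j)))"
      by (auto simp: b sum_distrib_left sum_distrib_right mult_ac intro!: sum.cong)
    also have "\<dots> = (\<Sum>p<n. c p * cnj (c p))"
      unfolding c_def cnj_sum sum_product by (rule sum_rotate)
    also have "\<dots> = complex_of_real (\<Sum>p<n. (cmod (c p))\<^sup>2)"
      unfolding of_real_sum complex_norm_square ..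
    finally show "0 \<le> (\<Sum>i<n. \<Sum>j<n. (1\<^sub>m n - \<rho>) $$ (i, j) * v j * cnj (v i))"
      using le by (simp add: nonneg_complex_iff)
  qed
qed

text \<open>Kept general in \<open>\<sigma>\<close>: for states it is normalisation, and for a state
  tensored with an identity it yields the dimension that appears in the upper bounds.\<close>

lemma povm_trace_sum:
  assumes T: "povm n Z T" and \<sigma>: "\<sigma> \<in> carrier_mat n n"
  shows "(\<Sum>z\<in>Z. mat_trace (T z * \<sigma>)) = mat_trace \<sigma>"
proof -
  have "(\<Sum>z\<in>Z. mat_trace (T z * \<sigma>)) = (\<Sum>z\<in>Z. \<Sum>i<n. \<Sum>j<n. T z $$ (i, j) * \<sigma> $$ (j, i))"
    using T \<sigma> by (intro sum.cong refl mat_trace_mult) (auto simp: povm_def psd_carrier)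
  also have "\<dots> = (\<Sum>i<n. \<Sum>z\<in>Z. \<Sum>j<n. T z $$ (i, j) * \<sigma> $$ (j, i))"
    by (rule sum.swap)
  also have "\<dots> = (\<Sum>i<n. \<Sum>j<n. (\<Sum>z\<in>Z. T z $$ (i, j)) * \<sigma> $$ (j, i))"
    by (simp add: sum_distrib_right sum.swap[of _ _ Z])
  also have "\<dots> = (\<Sum>i<n. \<Sum>j<n. (if i = j then \<sigma> $$ (j, i) else 0))"
    using T by (intro sum.cong refl) (auto simp: povm_def)
  also have "\<dots> = mat_trace \<sigma>"
    using \<sigma> by (simp add: mat_trace_def)
  finally show ?thesis .
qed

lemma mat_trace_kron_mult:
  assumes A: "A \<in> carrier_mat m m" and B: "B \<in> carrier_mat n n"
    and \<rho>: "\<rho> \<in> carrier_mat (m * n) (m * n)"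
  shows "mat_trace (kron A B * \<rho>) = (\<Sum>i<m. \<Sum>k<n. \<Sum>j<m. \<Sum>l<n.
    A $$ (i, j) * B $$ (k, l) * \<rho> $$ (j * n + l, i * n + k))"
proof -
  have "mat_trace (kron A B * \<rho>) = (\<Sum>p<m * n. \<Sum>q<m * n. kron A B $$ (p, q) * \<rho> $$ (q, p))"
    using kron_carrier[OF A B] \<rho> by (rule mat_trace_mult)
  also have "\<dots> = (\<Sum>i<m. \<Sum>k<n. \<Sum>j<m. \<Sum>l<n.
      kron A B $$ (i * n + k, j * n + l) * \<rho> $$ (j * n + l, i * n + k))"
    by (simp only: sum_lessThan_mult)
  also have "\<dots> = (\<Sum>i<m. \<Sum>k<n. \<Sum>j<m. \<Sum>l<n.
      A $$ (i, j) * B $$ (k, l) * \<rho> $$ (j * n + l, i * n + k))"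
    by (intro sum.cong refl) (simp add: kron_pair_index[OF A B])
  finally show ?thesis .
qed

lemma mat_trace_kron:
  assumes A: "A \<in> carrier_mat m m" and B: "B \<in> carrier_mat n n"
  shows "mat_trace (kron A B) = mat_trace A * mat_trace B"
proof -
  have "mat_trace (kron A B) = (\<Sum>i<m. \<Sum>k<n. kron A B $$ (i * n + k, i * n + k))"
    using kron_carrier[OF A B] by (simp add: mat_trace_def sum_lessThan_mult)
  also have "\<dots> = (\<Sum>i<m. \<Sum>k<n. A $$ (i, i) * B $$ (k, k))"
    by (intro sum.cong refl) (simp add: kron_pair_index[OF A B])
  also have "\<dots> = mat_trace A * mat_trace B"
    using A B by (simp add: mat_trace_def sum_product)
  finally show ?thesis .
qed

subsection \<open>Channels\<close>

lemma map_tensor_carrier: "map_tensor nA mA nB mB E F \<rho> \<in> carrier_mat (mA * mB) (mA * mB)"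
  by (simp add: map_tensor_def)

lemma map_tensor_pair_index:
  assumes E: "\<And>i j. i < nA \<Longrightarrow> j < nA \<Longrightarrow> E (mat_elem nA i j) \<in> carrier_mat mA mA"
    and F: "\<And>k l. k < nB \<Longrightarrow> l < nB \<Longrightarrow> F (mat_elem nB k l) \<in> carrier_mat mB mB"
    and less: "r < mA" "s < mA" "r' < mB" "s' < mB"
  shows "map_tensor nA mA nB mB E F \<rho> $$ (r * mB + r', s * mB + s') =
    (\<Sum>i<nA. \<Sum>j<nA. \<Sum>k<nB. \<Sum>l<nB. \<rho> $$ (i * nB + k, j * nB + l) *
      (E (mat_elem nA i j) $$ (r, s) * F (mat_elem nB k l) $$ (r', s')))"
proof -
  have "r * mB + r' < mA * mB" "s * mB + s' < mA * mB"
    using less by (auto intro: pair_index_less)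
  then have "map_tensor nA mA nB mB E F \<rho> $$ (r * mB + r', s * mB + s') =
      (\<Sum>i<nA. \<Sum>j<nA. \<Sum>k<nB. \<Sum>l<nB. \<rho> $$ (i * nB + k, j * nB + l) *
        kron (E (mat_elem nA i j)) (F (mat_elem nB k l)) $$ (r * mB + r', s * mB + s'))"
    by (simp add: map_tensor_def)
  also have "\<dots> = (\<Sum>i<nA. \<Sum>j<nA. \<Sum>k<nB. \<Sum>l<nB. \<rho> $$ (i * nB + k, j * nB + l) *
      (E (mat_elem nA i j) $$ (r, s) * F (mat_elem nB k l) $$ (r', s')))"
    by (intro sum.cong refl) (use E F less in \<open>simp add: kron_pair_index[where m = mA and n = mB]\<close>)
  finally show ?thesis .
qed

text \<open>A matrix of Gram form is mapped to one of Gram form: the factors are the images of the factors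
  of \<open>\<rho>\<close> under the products of the Kraus operators \<open>K p\<close> and \<open>L q\<close>.\<close>

lemma psd_map_tensor_kraus:
  assumes \<rho>: "psd (nA * nB) \<rho>"
    and E: "\<And>i j. i < nA \<Longrightarrow> j < nA \<Longrightarrow> E (mat_elem nA i j) \<in> carrier_mat mA mA"
    and F: "\<And>k l. k < nB \<Longrightarrow> l < nB \<Longrightarrow> F (mat_elem nB k l) \<in> carrier_mat mB mB"
    and K: "\<And>i j r s. i < nA \<Longrightarrow> j < nA \<Longrightarrow> r < mA \<Longrightarrow> s < mA \<Longrightarrow>
      E (mat_elem nA i j) $$ (r, s) = (\<Sum>p\<in>P. K p r i * cnj (K p s j))"
    and L: "\<And>k l r s. k < nB \<Longrightarrow> l < nB \<Longrightarrow> r < mB \<Longrightarrow> s < mB \<Longrightarrow>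
      F (mat_elem nB k l) $$ (r, s) = (\<Sum>q\<in>Q. L q r k * cnj (L q s l))"
  shows "psd (mA * mB) (map_tensor nA mA nB mB E F \<rho>)"
proof -
  obtain v where v: "\<And>i j. i < nA * nB \<Longrightarrow> j < nA * nB \<Longrightarrow>
      \<rho> $$ (i, j) = (\<Sum>t<nA * nB. v t i * cnj (v t j))"
    using psd_gramE[OF \<rho>] by blast
  define u where "u w r = (case w of (t, p, q) \<Rightarrow>
      \<Sum>(i, k)\<in>{..<nA} \<times> {..<nB}. v t (i * nB + k) * K p (r div mB) i * L q (r mod mB) k)"
    for w :: "nat \<times> 'a \<times> 'b" and r
  let ?W = "{..<nA * nB} \<times> P \<times> Q"
  show ?thesis
  proof (rule psd_gramI[where P = ?W and B = u])
    show "map_tensor nA mA nB mB E F \<rho> \<in> carrier_mat (mA * mB) (mA * mB)"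
      by (rule map_tensor_carrier)
    fix x y assume xy: "x < mA * mB" "y < mA * mB"
    then have "0 < mB" by (cases mB) auto
    define r r' s s' where "r = x div mB" "r' = x mod mB" "s = y div mB" "s' = y mod mB"
    have less: "r < mA" "s < mA" "r' < mB" "s' < mB"
      using xy \<open>0 < mB\<close> by (auto simp: r_r'_s_s'_def less_mult_imp_div_less)
    have "map_tensor nA mA nB mB E F \<rho> $$ (x, y)
        = map_tensor nA mA nB mB E F \<rho> $$ (r * mB + r', s * mB + s')"
      by (simp add: r_r'_s_s'_def)
    also have "\<dots> = (\<Sum>i<nA. \<Sum>j<nA. \<Sum>k<nB. \<Sum>l<nB. \<Sum>t<nA * nB. \<Sum>p\<in>P. \<Sum>q\<in>Q.
        v t (i * nB + k) * K p r i * L q r' k * cnj (v t (j * nB + l) * K p s j * L q s' l))"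
    proof (subst map_tensor_pair_index[where E = E and F = F, OF E F less], assumption+,
        intro sum.cong refl)
      fix i j k l assume "i \<in> {..<nA}" "j \<in> {..<nA}" "k \<in> {..<nB}" "l \<in> {..<nB}"
      then have ijkl: "i < nA" "j < nA" "k < nB" "l < nB" by auto
      show "\<rho> $$ (i * nB + k, j * nB + l) * (E (mat_elem nA i j) $$ (r, s) * F (mat_elem nB k l) $$ (r', s'))
          = (\<Sum>t<nA * nB. \<Sum>p\<in>P. \<Sum>q\<in>Q.
            v t (i * nB + k) * K p r i * L q r' k * cnj (v t (j * nB + l) * K p s j * L q s' l))"
        unfolding K[OF ijkl(1,2) less(1,2)] L[OF ijkl(3,4) less(3,4)]
          v[OF pair_index_less[OF ijkl(1,3)] pair_index_less[OF ijkl(2,4)]] sum_product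
        by (intro sum.cong refl) (simp add: sum_distrib_left mult_ac)
    qed
    \<comment> \<open>The seven sums are reordered by a single bijection of tuples, grouped into row
      indices \<open>(i, k)\<close> and column indices \<open>(j, l)\<close>, so that each
      \<open>w\<close> contributes a product of \<open>u\<close> and its conjugate.\<close>
    also have "\<dots> = (\<Sum>w\<in>?W. \<Sum>a\<in>{..<nA} \<times> {..<nB}. \<Sum>b\<in>{..<nA} \<times> {..<nB}.
        case w of (t, p, q) \<Rightarrow> case a of (i, k) \<Rightarrow> case b of (j, l) \<Rightarrow>
        v t (i * nB + k) * K p r i * L q r' k * cnj (v t (j * nB + l) * K p s j * L q s' l))"
      unfolding sum.cartesian_product
      by (rule sum.reindex_bij_witness[of _
            "\<lambda>((t, p, q), (i, k), (j, l)). (i, j, k, l, t, p, q)"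
            "\<lambda>(i, j, k, l, t, p, q). ((t, p, q), (i, k), (j, l))"]) auto
    also have "\<dots> = (\<Sum>w\<in>?W. u w x * cnj (u w y))"
    proof (intro sum.cong refl)
      fix w :: "nat \<times> 'a \<times> 'b"
      obtain t p q where w: "w = (t, p, q)" by (cases w)
      show "(\<Sum>a\<in>{..<nA} \<times> {..<nB}. \<Sum>b\<in>{..<nA} \<times> {..<nB}.
          case w of (t, p, q) \<Rightarrow> case a of (i, k) \<Rightarrow> case b of (j, l) \<Rightarrow>
          v t (i * nB + k) * K p r i * L q r' k * cnj (v t (j * nB + l) * K p s j * L q s' l))
        = u w x * cnj (u w y)"
        unfolding w u_def prod.case cnj_sum sum_product r_r'_s_s'_def
        by (intro sum.cong refl) (simp add: split_def)
    qed
    finally show "map_tensor nA mA nB mB E F \<rho> $$ (x, y) = (\<Sum>w\<in>?W. u w x * cnj (u w y))" .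
  qed
qed

lemma mat_elem_carrier: "mat_elem n i j \<in> carrier_mat n n"
  by (simp add: mat_elem_def)

text \<open>Choi's argument: \<open>\<Omega>\<close> is the rank-one operator of the unnormalised
  maximally entangled vector, and the block \<open>(i, j)\<close> of its image is
  \<open>E (mat_elem n i j)\<close>. Complete positivity with an ancilla of dimension
  \<open>n\<close> gives Gram vectors of this image; cut into \<open>n\<close> pieces of length
  \<open>m\<close>, they are the Kraus operators.\<close>

lemma channel_kraus:
  assumes E: "channel n m E"
  obtains K where "\<And>i j r s. i < n \<Longrightarrow> j < n \<Longrightarrow> r < m \<Longrightarrow> s < m \<Longrightarrow>
      E (mat_elem n i j) $$ (r, s) = (\<Sum>p<n * m. K p r i * cnj (K p s j))"
proof -
  define \<Omega> where "\<Omega> = mat (n * n) (n * n)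
    (\<lambda>(x, y). if x div n = x mod n \<and> y div n = y mod n then 1 else (0::complex))"
  have "psd (n * n) \<Omega>"
    by (rule psd_gramI[where P = "{()}" and B = "\<lambda>_ x. if x div n = x mod n then 1 else 0"])
      (auto simp: \<Omega>_def)
  then have "psd (n * m) (map_tensor n n n m (\<lambda>B. B) E \<Omega>)"
    using E by (simp add: channel_def completely_positive_def)
  then obtain b where b: "\<And>x y. x < n * m \<Longrightarrow> y < n * m \<Longrightarrow>
      map_tensor n n n m (\<lambda>B. B) E \<Omega> $$ (x, y) = (\<Sum>p<n * m. b p x * cnj (b p y))"
    using psd_gramE by blast
  have "E (mat_elem n i j) $$ (r, s) = (\<Sum>p<n * m. b p (i * m + r) * cnj (b p (j * m + s)))"
    if less: "i < n" "j < n" "r < m" "s < m" for i j r s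
  proof -
    have "map_tensor n n n m (\<lambda>B. B) E \<Omega> $$ (i * m + r, j * m + s)
        = (\<Sum>i'<n. \<Sum>j'<n. \<Sum>k<n. \<Sum>l<n. \<Omega> $$ (i' * n + k, j' * n + l) *
          (mat_elem n i' j' $$ (i, j) * E (mat_elem n k l) $$ (r, s)))"
      using E less by (intro map_tensor_pair_index)
        (auto simp: channel_def linear_map_def mat_elem_carrier)
    \<comment> \<open>\<open>\<Omega>\<close> forces \<open>k = i'\<close> and
      \<open>l = j'\<close>, the matrix unit forces \<open>i' = i\<close> and \<open>j' = j\<close>;
      the nesting lets the sums collapse from the inside.\<close>
    also have "\<dots> = (\<Sum>i'<n. \<Sum>j'<n. \<Sum>k<n. \<Sum>l<n. if l = j' then if k = i' then
        if j' = j then if i' = i then E (mat_elem n i j) $$ (r, s) else 0 else 0 else 0 else 0)"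
      by (intro sum.cong refl) (use less in \<open>auto simp: \<Omega>_def mat_elem_def pair_index_less\<close>)
    also have "\<dots> = E (mat_elem n i j) $$ (r, s)"
      using less by (simp add: sum.delta)
    finally show ?thesis
      using b[of "i * m + r" "j * m + s"] less by (simp add: pair_index_less)
  qed
  then show ?thesis
    by (rule that[of "\<lambda>p r i. b p (i * m + r)"])
qed

text \<open>Positivity comes from the Kraus operators of both maps. For the trace, images of matrix
  units have trace 0 or 1, so the expansion collapses to the trace of \<open>\<rho>\<close>.\<close>

lemma state_map_tensor:
  assumes \<rho>: "state (nA * nB) \<rho>" and E: "channel nA mA E" and F: "channel nB mB F"
  shows "state (mA * mB) (map_tensor nA mA nB mB E F \<rho>)"
proof -
  have carE: "E (mat_elem nA i j) \<in> carrier_mat mA mA" for i j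
    using E by (simp add: channel_def linear_map_def mat_elem_carrier)
  have carF: "F (mat_elem nB i j) \<in> carrier_mat mB mB" for i j
    using F by (simp add: channel_def linear_map_def mat_elem_carrier)
  have unit_trace: "mat_trace (mat_elem n i j) = (if i = j then 1 else 0)" if "i < n" for n i j
    using that by (auto simp: mat_trace_def mat_elem_def)
  have trE: "(\<Sum>r<mA. E (mat_elem nA i j) $$ (r, r)) = (if i = j then 1 else 0)" if "i < nA" for i j
  proof -
    have "mat_trace (E (mat_elem nA i j)) = mat_trace (mat_elem nA i j)"
      using E by (simp add: channel_def mat_elem_carrier)
    with unit_trace[OF that] carE[of i j] show ?thesis
      by (simp add: mat_trace_def[of "E (mat_elem nA i j)"])
  qed
  have trF: "(\<Sum>r<mB. F (mat_elem nB i j) $$ (r, r)) = (if i = j then 1 else 0)" if "i < nB" for i j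
  proof -
    have "mat_trace (F (mat_elem nB i j)) = mat_trace (mat_elem nB i j)"
      using F by (simp add: channel_def mat_elem_carrier)
    with unit_trace[OF that] carF[of i j] show ?thesis
      by (simp add: mat_trace_def[of "F (mat_elem nB i j)"])
  qed
  obtain K where K: "\<And>i j r s. i < nA \<Longrightarrow> j < nA \<Longrightarrow> r < mA \<Longrightarrow> s < mA \<Longrightarrow>
      E (mat_elem nA i j) $$ (r, s) = (\<Sum>p<nA * mA. K p r i * cnj (K p s j))"
    using channel_kraus[OF E] by blast
  obtain L where L: "\<And>i j r s. i < nB \<Longrightarrow> j < nB \<Longrightarrow> r < mB \<Longrightarrow> s < mB \<Longrightarrow>
      F (mat_elem nB i j) $$ (r, s) = (\<Sum>p<nB * mB. L p r i * cnj (L p s j))"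
    using channel_kraus[OF F] by blast
  have "psd (mA * mB) (map_tensor nA mA nB mB E F \<rho>)"
    by (rule psd_map_tensor_kraus[where P = "{..<nA * mA}" and K = K
          and Q = "{..<nB * mB}" and L = L])
      (use \<rho> in \<open>simp_all add: state_def carE carF K L\<close>)
  moreover have "mat_trace (map_tensor nA mA nB mB E F \<rho>) = 1"
  proof -
    have "mat_trace (map_tensor nA mA nB mB E F \<rho>)
        = (\<Sum>r<mA. \<Sum>r'<mB. map_tensor nA mA nB mB E F \<rho> $$ (r * mB + r', r * mB + r'))"
      using map_tensor_carrier[of nA mA nB mB E F \<rho>]
      by (simp add: mat_trace_def sum_lessThan_mult)
    also have "\<dots> = (\<Sum>r<mA. \<Sum>r'<mB. \<Sum>i<nA. \<Sum>j<nA. \<Sum>k<nB. \<Sum>l<nB. \<rho> $$ (i * nB + k, j * nB + l) *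
      (E (mat_elem nA i j) $$ (r, r) * F (mat_elem nB k l) $$ (r', r')))"
      by (intro sum.cong refl map_tensor_pair_index) (auto simp: carE carF)
    also have "\<dots> = (\<Sum>i<nA. \<Sum>j<nA. \<Sum>k<nB. \<Sum>l<nB. \<Sum>r<mA. \<Sum>r'<mB. \<rho> $$ (i * nB + k, j * nB + l) *
      (E (mat_elem nA i j) $$ (r, r) * F (mat_elem nB k l) $$ (r', r')))"
      unfolding sum.cartesian_product
      by (rule sum.reindex_bij_witness[of _
            "\<lambda>(i, j, k, l, r, r'). (r, r', i, j, k, l)"
            "\<lambda>(r, r', i, j, k, l). (i, j, k, l, r, r')"]) auto
    also have "\<dots> = (\<Sum>i<nA. \<Sum>j<nA. \<Sum>k<nB. \<Sum>l<nB. \<rho> $$ (i * nB + k, j * nB + l) *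
      ((\<Sum>r<mA. E (mat_elem nA i j) $$ (r, r)) * (\<Sum>r'<mB. F (mat_elem nB k l) $$ (r', r'))))"
      by (simp only: sum_product) (simp only: sum_distrib_left)
    also have "\<dots> = (\<Sum>i<nA. \<Sum>j<nA. \<Sum>k<nB. \<Sum>l<nB. if l = k then if j = i then
        \<rho> $$ (i * nB + k, i * nB + k) else 0 else 0)"
      by (intro sum.cong refl) (auto simp: trE trF)
    also have "\<dots> = (\<Sum>i<nA. \<Sum>j<nA. if j = i then \<Sum>k<nB. \<rho> $$ (i * nB + k, i * nB + k) else 0)"
      by (intro sum.cong refl) auto
    also have "\<dots> = (\<Sum>i<nA. \<Sum>k<nB. \<rho> $$ (i * nB + k, i * nB + k))"
      by (simp add: sum.delta)
    also have "\<dots> = mat_trace \<rho>"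
      using \<rho> psd_carrier[of "nA * nB" \<rho>] by (simp add: mat_trace_def state_def sum_lessThan_mult)
    finally show ?thesis
      using \<rho> by (simp add: state_def)
  qed
  ultimately show ?thesis
    by (simp add: state_def)
qed

text \<open>The map taking \<open>A\<close> to \<open>V\<close>, \<open>A\<close> and the adjoint of
  \<open>V\<close> multiplied in this order: a single Kraus operator, an \<open>m\<close> by
  \<open>n\<close> matrix passed as a function of its indices.\<close>

definition conj_map :: "nat \<Rightarrow> nat \<Rightarrow> (nat \<Rightarrow> nat \<Rightarrow> complex) \<Rightarrow> complex mat \<Rightarrow> complex mat" where
  "conj_map n m V A = mat m m (\<lambda>(r, s). \<Sum>i<n. \<Sum>j<n. V r i * A $$ (i, j) * cnj (V s j))"

lemma conj_map_mat_elem: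
  assumes "i < n" "j < n" "r < m" "s < m"
  shows "conj_map n m V (mat_elem n i j) $$ (r, s) = V r i * cnj (V s j)"
proof -
  have "conj_map n m V (mat_elem n i j) $$ (r, s)
      = (\<Sum>i'<n. \<Sum>j'<n. V r i' * mat_elem n i j $$ (i', j') * cnj (V s j'))"
    using assms by (simp add: conj_map_def)
  also have "\<dots>
      = (\<Sum>i'<n. \<Sum>j'<n. if j' = j then if i' = i then V r i * cnj (V s j) else 0 else 0)"
    by (intro sum.cong refl) (auto simp: mat_elem_def)
  also have "\<dots> = V r i * cnj (V s j)"
    using assms by (simp add: sum.delta)
  finally show ?thesis .
qed

text \<open>Orthonormal columns of \<open>V\<close> preserve the trace; complete positivity holds
  because the identity on the ancilla and the map itself have one Kraus operator each.\<close>

lemma channel_conj_map: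
  assumes isometry: "\<And>i j. i < n \<Longrightarrow> j < n \<Longrightarrow>
      (\<Sum>r<m. V r i * cnj (V r j)) = (if i = j then 1 else 0)"
  shows "channel n m (conj_map n m V)"
  unfolding channel_def
proof (intro conjI ballI)
  show "linear_map n m (conj_map n m V)"
    unfolding linear_map_def
  proof (intro conjI ballI allI)
    show "conj_map n m V A \<in> carrier_mat m m" for A
      by (simp add: conj_map_def)
    show "conj_map n m V (A + B) = conj_map n m V A + conj_map n m V B"
      if "A \<in> carrier_mat n n" "B \<in> carrier_mat n n" for A B
      using that by (intro eq_matI)
        (auto simp: conj_map_def distrib_left distrib_right sum.distrib)
    show "conj_map n m V (c \<cdot>\<^sub>m A) = c \<cdot>\<^sub>m conj_map n m V A"
      if "A \<in> carrier_mat n n" for c A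
      using that by (intro eq_matI)
        (auto simp: conj_map_def sum_distrib_left mult_ac intro!: sum.cong)
  qed
  show "completely_positive n m (conj_map n m V)"
    unfolding completely_positive_def
  proof (intro allI impI)
    fix k A assume A: "psd (k * n) A"
    show "psd (k * m) (map_tensor k k n m (\<lambda>B. B) (conj_map n m V) A)"
    proof (rule psd_map_tensor_kraus[OF A, where P = "{()}" and Q = "{()}"
          and K = "\<lambda>_ r i. if r = i then 1 else 0" and L = "\<lambda>_. V"])
      show "conj_map n m V (mat_elem n i j) \<in> carrier_mat m m" for i j
        by (simp add: conj_map_def)
      show "mat_elem k i j \<in> carrier_mat k k" for i j
        by (rule mat_elem_carrier)
      show "conj_map n m V (mat_elem n i j) $$ (r, s) = (\<Sum>q\<in>{()}. V r i * cnj (V s j))"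
        if "i < n" "j < n" "r < m" "s < m" for i j r s
        using that by (simp add: conj_map_mat_elem)
    qed (auto simp: mat_elem_def)
  qed
  fix A :: "complex mat" assume A: "A \<in> carrier_mat n n"
  have "mat_trace (conj_map n m V A) = (\<Sum>r<m. \<Sum>i<n. \<Sum>j<n. V r i * A $$ (i, j) * cnj (V r j))"
    by (simp add: conj_map_def mat_trace_def)
  also have "\<dots> = (\<Sum>i<n. \<Sum>j<n. \<Sum>r<m. A $$ (i, j) * (V r i * cnj (V r j)))"
    by (subst sum_rotate[symmetric]) (simp add: mult_ac)
  also have "\<dots> = (\<Sum>i<n. \<Sum>j<n. if j = i then A $$ (i, i) else 0)"
    unfolding sum_distrib_left[symmetric] by (intro sum.cong refl) (simp add: isometry)
  also have "\<dots> = mat_trace A"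
    using A by (simp add: mat_trace_def)
  finally show "mat_trace (conj_map n m V A) = mat_trace A" .
qed

subsection \<open>Inclusions between the sets of conditional distributions\<close>

text \<open>Carrier of classical data: distributions become diagonal states, decoders become
  diagonal measurements.\<close>

definition diag_real :: "nat \<Rightarrow> (nat \<Rightarrow> real) \<Rightarrow> complex mat" where
  "diag_real n c = mat n n (\<lambda>(i, j). if i = j then complex_of_real (c i) else 0)"

lemma diag_real_carrier: "diag_real n c \<in> carrier_mat n n"
  by (simp add: diag_real_def)

lemma psd_diag_real:
  assumes "\<And>i. i < n \<Longrightarrow> 0 \<le> c i"
  shows "psd n (diag_real n c)"
proof (rule psdI[OF diag_real_carrier])
  fix v :: "nat \<Rightarrow> complex"
  have "(\<Sum>i<n. \<Sum>j<n. diag_real n c $$ (i, j) * v j * cnj (v i))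
      = (\<Sum>i<n. \<Sum>j<n. if j = i then complex_of_real (c i) * (v i * cnj (v i)) else 0)"
    by (intro sum.cong refl) (auto simp: diag_real_def)
  also have "\<dots> = (\<Sum>i<n. complex_of_real (c i) * (v i * cnj (v i)))"
    by simp
  also have "0 \<le> \<dots>"
    using assms by (intro sum_nonneg mult_nonneg_nonneg mult_cnj_nonneg)
      (auto simp: nonneg_complex_iff)
  finally show "0 \<le> (\<Sum>i<n. \<Sum>j<n. diag_real n c $$ (i, j) * v j * cnj (v i))" .
qed

lemma state_diag_real: "prob_dist {..<n} p \<Longrightarrow> state n (diag_real n p)"
  using psd_diag_real[of n p]
  by (auto simp: state_def prob_dist_def mat_trace_def diag_real_def simp flip: of_real_sum)

lemma povm_diag_real:
  assumes "\<And>i. i < n \<Longrightarrow> prob_dist Z (R i)"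
  shows "povm n Z (\<lambda>z. diag_real n (\<lambda>i. R i z))"
  unfolding povm_def
proof (intro conjI ballI allI impI)
  show "psd n (diag_real n (\<lambda>i. R i z))" if "z \<in> Z" for z
    using assms that by (intro psd_diag_real) (auto simp: prob_dist_def)
  fix i j assume "i < n" "j < n"
  then show "(\<Sum>z\<in>Z. diag_real n (\<lambda>i. R i z) $$ (i, j)) = 1\<^sub>m n $$ (i, j)"
    using assms[of i]
    by (cases "i = j") (auto simp: diag_real_def prob_dist_def simp flip: of_real_sum)
qed

lemma mat_trace_diag_real_mult:
  assumes "A \<in> carrier_mat n n"
  shows "mat_trace (diag_real n c * A) = (\<Sum>i<n. complex_of_real (c i) * A $$ (i, i))"
proof -
  have "mat_trace (diag_real n c * A)
      = (\<Sum>i<n. \<Sum>j<n. if j = i then complex_of_real (c i) * A $$ (i, i) else 0)"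
    unfolding mat_trace_mult[OF diag_real_carrier assms]
    by (intro sum.cong refl) (auto simp: diag_real_def)
  then show ?thesis by simp
qed

text \<open>The shared system can be trivial: in dimension 1 a measurement is a distribution, so the
  local randomness is put into the measurements.\<close>

lemma C_set_subset_CE_set: "C_set X Y Z d1 d2 \<subseteq> CE_set X Y Z d1 d2"
proof
  fix Q assume "Q \<in> C_set X Y Z d1 d2"
  then obtain P1 P2 R where P1: "\<And>x. x \<in> X \<Longrightarrow> prob_dist {..<d1} (P1 x)"
    and P2: "\<And>y. y \<in> Y \<Longrightarrow> prob_dist {..<d2} (P2 y)"
    and R: "\<forall>a<d1. \<forall>b<d2. prob_dist Z (R a b)"
    and Q: "\<And>x y z. x \<in> X \<Longrightarrow> y \<in> Y \<Longrightarrow> z \<in> Z \<Longrightarrow>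
      Q x y z = (\<Sum>a<d1. \<Sum>b<d2. R a b z * P1 x a * P2 y b)"
    unfolding C_set_def by blast
  define N where "N x y a b = P1 x a * P2 y b" for x y a b
  have "entangled X Y d1 d2 N"
    unfolding entangled_def
  proof (intro exI conjI ballI allI impI)
    show "state (1 * 1) (diag_real 1 (\<lambda>_. 1))"
      using state_diag_real[of 1 "\<lambda>_. 1"] by (simp add: prob_dist_def)
    show "povm 1 {..<d1} (\<lambda>a. diag_real 1 (\<lambda>_. P1 x a))" if "x \<in> X" for x
      using P1[OF that] by (rule povm_diag_real)
    show "povm 1 {..<d2} (\<lambda>b. diag_real 1 (\<lambda>_. P2 y b))" if "y \<in> Y" for y
      using P2[OF that] by (rule povm_diag_real)
    show "complex_of_real (N x y a b) = mat_trace
        (kron (diag_real 1 (\<lambda>_. P1 x a)) (diag_real 1 (\<lambda>_. P2 y b)) * diag_real 1 (\<lambda>_. 1))" for x y a b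
      by (subst mat_trace_kron_mult[where m = 1 and n = 1])
        (simp_all add: diag_real_def N_def)
  qed
  moreover have "Q \<in> decoded X Y Z d1 d2 N"
    unfolding decoded_def using R Q by (auto simp: N_def mult.assoc)
  ultimately show "Q \<in> CE_set X Y Z d1 d2"
    unfolding CE_set_def by blast
qed

text \<open>Messages are sent as diagonal states and read in the product basis;
  \<open>p div d2\<close> and \<open>p mod d2\<close> recover them from the basis index.\<close>

lemma C_set_subset_Q_set: "C_set X Y Z d1 d2 \<subseteq> Q_set X Y Z d1 d2"
proof
  fix Q assume "Q \<in> C_set X Y Z d1 d2"
  then obtain P1 P2 R where P1: "\<And>x. x \<in> X \<Longrightarrow> prob_dist {..<d1} (P1 x)"
    and P2: "\<And>y. y \<in> Y \<Longrightarrow> prob_dist {..<d2} (P2 y)"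
    and R: "\<And>a b. a < d1 \<Longrightarrow> b < d2 \<Longrightarrow> prob_dist Z (R a b)"
    and Q: "\<And>x y z. x \<in> X \<Longrightarrow> y \<in> Y \<Longrightarrow> z \<in> Z \<Longrightarrow>
      Q x y z = (\<Sum>a<d1. \<Sum>b<d2. R a b z * P1 x a * P2 y b)"
    unfolding C_set_def by blast
  have "povm (d1 * d2) Z (\<lambda>z. diag_real (d1 * d2) (\<lambda>p. R (p div d2) (p mod d2) z))"
  proof (rule povm_diag_real)
    fix p assume p: "p < d1 * d2"
    then have "0 < d2" by (cases d2) auto
    with p show "prob_dist Z (R (p div d2) (p mod d2))"
      by (intro R) (auto simp: less_mult_imp_div_less)
  qed
  moreover have "complex_of_real (Q x y z) = mat_trace
      (diag_real (d1 * d2) (\<lambda>p. R (p div d2) (p mod d2) z) *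
       kron (diag_real d1 (P1 x)) (diag_real d2 (P2 y)))"
    if "x \<in> X" "y \<in> Y" "z \<in> Z" for x y z
  proof -
    have "mat_trace (diag_real (d1 * d2) (\<lambda>p. R (p div d2) (p mod d2) z) *
        kron (diag_real d1 (P1 x)) (diag_real d2 (P2 y)))
      = (\<Sum>p<d1 * d2. complex_of_real (R (p div d2) (p mod d2) z) *
          kron (diag_real d1 (P1 x)) (diag_real d2 (P2 y)) $$ (p, p))"
      by (intro mat_trace_diag_real_mult kron_carrier diag_real_carrier)
    also have "\<dots> = (\<Sum>a<d1. \<Sum>b<d2. complex_of_real (R a b z) *
          kron (diag_real d1 (P1 x)) (diag_real d2 (P2 y)) $$ (a * d2 + b, a * d2 + b))"
      unfolding sum_lessThan_mult by (intro sum.cong refl) simp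
    also have "\<dots> = (\<Sum>a<d1. \<Sum>b<d2. complex_of_real (R a b z * P1 x a * P2 y b))"
      by (intro sum.cong refl)
        (subst kron_pair_index[where m = d1 and n = d2], auto simp: diag_real_def)
    finally show ?thesis
      by (simp add: Q[OF that])
  qed
  ultimately show "Q \<in> Q_set X Y Z d1 d2"
    unfolding Q_set_def using P1 P2
    by (intro CollectI exI[of _ "\<lambda>x. diag_real d1 (P1 x)"] exI[of _ "\<lambda>y. diag_real d2 (P2 y)"] exI)
      (auto simp: state_diag_real)
qed

section \<open>Entangled boxes are nonsignaling\<close>

lemma povm_kron:
  assumes M: "povm m I M" and L: "povm n J L"
  shows "povm (m * n) (I \<times> J) (\<lambda>(a, b). kron (M a) (L b))"
  unfolding povm_def
proof (intro conjI ballI allI impI)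
  show "psd (m * n) (case p of (a, b) \<Rightarrow> kron (M a) (L b))" if "p \<in> I \<times> J" for p
    using that M L by (auto simp: povm_def intro!: psd_kron)
  fix i j assume ij: "i < m * n" "j < m * n"
  then have "0 < n" by (cases n) auto
  with ij have less: "i div n < m" "j div n < m" "i mod n < n" "j mod n < n"
    by (auto simp: less_mult_imp_div_less)
  have "(\<Sum>p\<in>I \<times> J. (case p of (a, b) \<Rightarrow> kron (M a) (L b)) $$ (i, j))
      = (\<Sum>(a, b)\<in>I \<times> J. M a $$ (i div n, j div n) * L b $$ (i mod n, j mod n))"
    using M L ij by (intro sum.cong refl)
      (auto simp: povm_def psd_carrier kron_index[where m = m and n = n])
  also have "\<dots> = (\<Sum>a\<in>I. M a $$ (i div n, j div n)) * (\<Sum>b\<in>J. L b $$ (i mod n, j mod n))"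
    by (simp add: sum_product sum.cartesian_product)
  also have "\<dots> = 1\<^sub>m m $$ (i div n, j div n) * 1\<^sub>m n $$ (i mod n, j mod n)"
    using M L less by (simp add: povm_def)
  also have "\<dots> = 1\<^sub>m (m * n) $$ (i, j)"
    using ij less by (auto, metis div_mult_mod_eq)
  finally show "(\<Sum>p\<in>I \<times> J. (case p of (a, b) \<Rightarrow> kron (M a) (L b)) $$ (i, j)) = 1\<^sub>m (m * n) $$ (i, j)" .
qed

text \<open>The reason why entanglement does not signal: the operators of the right measurement add
  up to the identity, so the left marginal does not depend on \<open>L\<close>.\<close>

lemma povm_trace_kron_sum_right:
  assumes L: "povm n J L" and A: "A \<in> carrier_mat m m" and \<rho>: "\<rho> \<in> carrier_mat (m * n) (m * n)"
  shows "(\<Sum>b\<in>J. mat_trace (kron A (L b) * \<rho>)) = mat_trace (kron A (1\<^sub>m n) * \<rho>)"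
proof -
  have "(\<Sum>b\<in>J. mat_trace (kron A (L b) * \<rho>)) = (\<Sum>b\<in>J. \<Sum>i<m. \<Sum>k<n. \<Sum>j<m. \<Sum>l<n.
      A $$ (i, j) * L b $$ (k, l) * \<rho> $$ (j * n + l, i * n + k))"
    using L by (intro sum.cong refl mat_trace_kron_mult A \<rho>) (auto simp: povm_def psd_carrier)
  also have "\<dots> = (\<Sum>i<m. \<Sum>k<n. \<Sum>j<m. \<Sum>l<n. \<Sum>b\<in>J.
      A $$ (i, j) * L b $$ (k, l) * \<rho> $$ (j * n + l, i * n + k))"
    by (simp only: sum.swap[where A = J])
  also have "\<dots> = (\<Sum>i<m. \<Sum>k<n. \<Sum>j<m. \<Sum>l<n.
      A $$ (i, j) * 1\<^sub>m n $$ (k, l) * \<rho> $$ (j * n + l, i * n + k))"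
    using L by (intro sum.cong refl)
      (auto simp: povm_def simp flip: sum_distrib_left sum_distrib_right)
  also have "\<dots> = mat_trace (kron A (1\<^sub>m n) * \<rho>)"
    using A \<rho> by (intro mat_trace_kron_mult[symmetric]) auto
  finally show ?thesis .
qed

lemma povm_trace_kron_sum_left:
  assumes M: "povm m I M" and B: "B \<in> carrier_mat n n" and \<rho>: "\<rho> \<in> carrier_mat (m * n) (m * n)"
  shows "(\<Sum>a\<in>I. mat_trace (kron (M a) B * \<rho>)) = mat_trace (kron (1\<^sub>m m) B * \<rho>)"
proof -
  have "(\<Sum>a\<in>I. mat_trace (kron (M a) B * \<rho>)) = (\<Sum>a\<in>I. \<Sum>i<m. \<Sum>k<n. \<Sum>j<m. \<Sum>l<n.
      M a $$ (i, j) * B $$ (k, l) * \<rho> $$ (j * n + l, i * n + k))"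
    using M by (intro sum.cong refl mat_trace_kron_mult B \<rho>) (auto simp: povm_def psd_carrier)
  also have "\<dots> = (\<Sum>i<m. \<Sum>k<n. \<Sum>j<m. \<Sum>l<n. \<Sum>a\<in>I.
      M a $$ (i, j) * B $$ (k, l) * \<rho> $$ (j * n + l, i * n + k))"
    by (simp only: sum.swap[where A = I])
  also have "\<dots> = (\<Sum>i<m. \<Sum>k<n. \<Sum>j<m. \<Sum>l<n.
      1\<^sub>m m $$ (i, j) * B $$ (k, l) * \<rho> $$ (j * n + l, i * n + k))"
    using M by (intro sum.cong refl)
      (auto simp: povm_def simp flip: sum_distrib_left sum_distrib_right)
  also have "\<dots> = mat_trace (kron (1\<^sub>m m) B * \<rho>)"
    using B \<rho> by (intro mat_trace_kron_mult[symmetric]) auto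
  finally show ?thesis .
qed

lemma entangled_imp_nonsignaling:
  assumes "entangled X Y d1 d2 N"
  shows "nonsignaling X Y d1 d2 N"
proof -
  from assms obtain nA nB \<rho> M L where \<rho>: "state (nA * nB) \<rho>"
    and M: "\<And>x. x \<in> X \<Longrightarrow> povm nA {..<d1} (M x)"
    and L: "\<And>y. y \<in> Y \<Longrightarrow> povm nB {..<d2} (L y)"
    and N: "\<And>x y a b. x \<in> X \<Longrightarrow> y \<in> Y \<Longrightarrow> a < d1 \<Longrightarrow> b < d2 \<Longrightarrow>
      complex_of_real (N x y a b) = mat_trace (kron (M x a) (L y b) * \<rho>)"
    unfolding entangled_def by blast
  have car: "\<rho> \<in> carrier_mat (nA * nB) (nA * nB)" and psd: "psd (nA * nB) \<rho>"
    using \<rho> by (auto simp: state_def psd_carrier)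
  have right: "complex_of_real (\<Sum>b<d2. N x y a b) = mat_trace (kron (M x a) (1\<^sub>m nB) * \<rho>)"
    if "x \<in> X" "y \<in> Y" "a < d1" for x y a
    using that M[OF that(1)] povm_trace_kron_sum_right[OF L[OF that(2)] _ car, of "M x a"]
    by (simp add: N povm_def psd_carrier)
  have left: "complex_of_real (\<Sum>a<d1. N x y a b) = mat_trace (kron (1\<^sub>m nA) (L y b) * \<rho>)"
    if "x \<in> X" "y \<in> Y" "b < d2" for x y b
    using that L[OF that(2)] povm_trace_kron_sum_left[OF M[OF that(1)] _ car, of "L y b"]
    by (simp add: N povm_def psd_carrier)
  show ?thesis
    unfolding nonsignaling_def
  proof (intro conjI ballI allI impI)
    fix x y assume xy: "x \<in> X" "y \<in> Y"
    have "0 \<le> N x y a b" if "a < d1" "b < d2" for a b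
    proof -
      have "psd nA (M x a)" "psd nB (L y b)"
        using M[OF xy(1)] L[OF xy(2)] that by (auto simp: povm_def)
      then have "0 \<le> complex_of_real (N x y a b)"
        unfolding N[OF xy that] by (intro trace_psd_mult_nonneg[OF psd_kron psd])
      then show ?thesis by (simp add: nonneg_complex_iff)
    qed
    moreover have "(\<Sum>(a, b)\<in>{..<d1} \<times> {..<d2}. N x y a b) = 1"
    proof -
      have "complex_of_real (\<Sum>(a, b)\<in>{..<d1} \<times> {..<d2}. N x y a b)
          = (\<Sum>p\<in>{..<d1} \<times> {..<d2}. mat_trace ((case p of (a, b) \<Rightarrow> kron (M x a) (L y b)) * \<rho>))"
        unfolding of_real_sum by (intro sum.cong refl) (auto simp: N xy)
      also have "\<dots> = mat_trace \<rho>"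
        by (rule povm_trace_sum[OF povm_kron[OF M[OF xy(1)] L[OF xy(2)]] car])
      finally show ?thesis
        using \<rho> unfolding state_def by (metis of_real_eq_1_iff)
    qed
    ultimately show "prob_dist ({..<d1} \<times> {..<d2}) (\<lambda>(a, b). N x y a b)"
      by (auto simp: prob_dist_def)
  next
    fix x y y' a assume "x \<in> X" "y \<in> Y" "y' \<in> Y" "a < d1"
    then show "(\<Sum>b<d2. N x y a b) = (\<Sum>b<d2. N x y' a b)"
      using right by (metis of_real_eq_iff)
  next
    fix x x' y b assume "x \<in> X" "x' \<in> X" "y \<in> Y" "b < d2"
    then show "(\<Sum>a<d1. N x y a b) = (\<Sum>a<d1. N x' y a b)"
      using left by (metis of_real_eq_iff)
  qed
qed

lemma CE_set_subset_CN_set: "CE_set X Y Z d1 d2 \<subseteq> CN_set X Y Z d1 d2"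
  unfolding CE_set_def CN_set_def using entangled_imp_nonsignaling by blast

subsection \<open>Upper bounds\<close>

text \<open>If \<open>B\<close> bounds \<open>Q\<close> independently of \<open>x\<close>, then for fixed \<open>y\<close> the values \<open>f x y\<close> run through \<open>Z\<close>
  exactly once, so that the total weight \<open>c\<close> of \<open>B y\<close> bounds the sum over \<open>x\<close>.\<close>

lemma success_sum_le:
  fixes B :: "'y \<Rightarrow> 'z \<Rightarrow> real"
  assumes bij: "\<And>y. y \<in> Y \<Longrightarrow> bij_betw (\<lambda>x. f x y) X Z"
    and le: "\<And>x y. x \<in> X \<Longrightarrow> y \<in> Y \<Longrightarrow> Q x y (f x y) \<le> B y (f x y)"
    and B: "\<And>y. y \<in> Y \<Longrightarrow> (\<Sum>z\<in>Z. B y z) = c"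
  shows "(\<Sum>x\<in>X. \<Sum>y\<in>Y. Q x y (f x y)) \<le> real (card Y) * c"
proof -
  have "(\<Sum>x\<in>X. \<Sum>y\<in>Y. Q x y (f x y)) = (\<Sum>y\<in>Y. \<Sum>x\<in>X. Q x y (f x y))"
    by (rule sum.swap)
  also have "\<dots> \<le> (\<Sum>y\<in>Y. \<Sum>x\<in>X. B y (f x y))"
    using le by (intro sum_mono)
  also have "\<dots> = (\<Sum>y\<in>Y. \<Sum>z\<in>Z. B y z)"
    using bij by (intro sum.cong refl sum.reindex_bij_betw)
  also have "\<dots> = real (card Y) * c"
    using B by simp
  finally show ?thesis .
qed

lemma succ_prob_le_left:
  fixes B :: "'y \<Rightarrow> 'z \<Rightarrow> real"
  assumes "dcb X Y Z f" "card Y > 0"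
    and "\<And>x y. x \<in> X \<Longrightarrow> y \<in> Y \<Longrightarrow> Q x y (f x y) \<le> B y (f x y)"
    and "\<And>y. y \<in> Y \<Longrightarrow> (\<Sum>z\<in>Z. B y z) = c"
  shows "succ_prob X Y f Q \<le> c / real (card X)"
proof -
  have "(\<Sum>x\<in>X. \<Sum>y\<in>Y. Q x y (f x y)) \<le> real (card Y) * c"
    using assms by (intro success_sum_le[where Z = Z and B = B]) (auto simp: dcb_def)
  then have "succ_prob X Y f Q \<le> (real (card Y) * c) / (real (card X) * real (card Y))"
    unfolding succ_prob_def by (intro divide_right_mono) auto
  also have "\<dots> = c / real (card X)"
    using assms(2) by simp
  finally show ?thesis .
qed

lemma succ_prob_le_right:
  fixes B :: "'x \<Rightarrow> 'z \<Rightarrow> real"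
  assumes "dcb X Y Z f" "card X > 0"
    and "\<And>x y. x \<in> X \<Longrightarrow> y \<in> Y \<Longrightarrow> Q x y (f x y) \<le> B x (f x y)"
    and "\<And>x. x \<in> X \<Longrightarrow> (\<Sum>z\<in>Z. B x z) = c"
  shows "succ_prob X Y f Q \<le> c / real (card Y)"
proof -
  have "succ_prob Y X (\<lambda>y x. f x y) (\<lambda>y x. Q x y) \<le> c / real (card Y)"
    using assms by (intro succ_prob_le_left[where Z = Z and B = B]) (auto simp: dcb_def)
  moreover have "succ_prob Y X (\<lambda>y x. f x y) (\<lambda>y x. Q x y) = succ_prob X Y f Q"
    unfolding succ_prob_def by (subst sum.swap) (simp add: mult.commute)
  ultimately show ?thesis by simp
qed

section \<open>The bound for nonsignaling boxes\<close>

lemma prob_dist_decoded_sum: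
  assumes "\<And>a b. a < d1 \<Longrightarrow> b < d2 \<Longrightarrow> prob_dist Z (R a b)"
  shows "(\<Sum>z\<in>Z. \<Sum>a<d1. \<Sum>b<d2. R a b z * w a b) = (\<Sum>a<d1. \<Sum>b<d2. w a b)"
proof -
  have "(\<Sum>z\<in>Z. \<Sum>a<d1. \<Sum>b<d2. R a b z * w a b)
      = (\<Sum>a<d1. \<Sum>b<d2. (\<Sum>z\<in>Z. R a b z) * w a b)"
    unfolding sum_distrib_right by (rule sum_rotate[symmetric])
  then show ?thesis
    using assms by (simp add: prob_dist_def)
qed

lemma CN_set_succ_prob_le:
  assumes dcb: "dcb X Y Z f" and card: "card X = n" "card Y = n" "0 < n"
    and Q: "Q \<in> CN_set X Y Z d1 d2"
  shows "succ_prob X Y f Q \<le> real (min d1 d2) / real n"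
proof -
  from Q obtain N R where N: "nonsignaling X Y d1 d2 N"
    and R: "\<And>a b. a < d1 \<Longrightarrow> b < d2 \<Longrightarrow> prob_dist Z (R a b)"
    and Q: "\<And>x y z. x \<in> X \<Longrightarrow> y \<in> Y \<Longrightarrow> z \<in> Z \<Longrightarrow>
      Q x y z = (\<Sum>a<d1. \<Sum>b<d2. R a b z * N x y a b)"
    unfolding CN_set_def decoded_def by blast
  have f: "f x y \<in> Z" if "x \<in> X" "y \<in> Y" for x y
    using dcb that by (auto simp: dcb_def bij_betw_def)
  have dist: "prob_dist ({..<d1} \<times> {..<d2}) (\<lambda>(a, b). N x y a b)" if "x \<in> X" "y \<in> Y" for x y
    using N that unfolding nonsignaling_def by blast
  have nonneg: "0 \<le> N x y a b" if "x \<in> X" "y \<in> Y" "a < d1" "b < d2" for x y a b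
    using dist[OF that(1,2)] that(3,4) by (auto simp: prob_dist_def)
  have total: "(\<Sum>a<d1. \<Sum>b<d2. N x y a b) = 1" if "x \<in> X" "y \<in> Y" for x y
    using dist[OF that] by (simp add: prob_dist_def sum.cartesian_product)
  have Rnonneg: "0 \<le> R a b z" if "a < d1" "b < d2" "z \<in> Z" for a b z
    using R that by (simp add: prob_dist_def)
  obtain x0 y0 where x0: "x0 \<in> X" and y0: "y0 \<in> Y"
    using card by (metis card_gt_0_iff ex_in_conv)
  have "succ_prob X Y f Q \<le> real d1 / real (card X)"
  proof (rule succ_prob_le_left[OF dcb])
    \<comment> \<open>The marginal of \<open>b\<close> at a reference input \<open>x0\<close>; by
      nonsignaling it is the marginal at every \<open>x\<close>, so the bound loses its dependence
      on \<open>x\<close>.\<close>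
    define NB where "NB y b = (\<Sum>a<d1. N x0 y a b)" for y b
    show "Q x y (f x y) \<le> (\<Sum>a<d1. \<Sum>b<d2. R a b (f x y) * NB y b)" if "x \<in> X" "y \<in> Y" for x y
    proof -
      have "N x y a b \<le> NB y b" if "a < d1" "b < d2" for a b
      proof -
        have "N x y a b \<le> (\<Sum>a<d1. N x y a b)"
          using nonneg \<open>x \<in> X\<close> \<open>y \<in> Y\<close> that by (intro member_le_sum) auto
        also have "\<dots> = NB y b"
          using N \<open>x \<in> X\<close> \<open>y \<in> Y\<close> x0 that unfolding nonsignaling_def NB_def by blast
        finally show ?thesis .
      qed
      then show ?thesis
        unfolding Q[OF that f[OF that]] using Rnonneg f[OF that]
        by (intro sum_mono mult_left_mono) auto
    qed
    \<comment> \<open>Summing over \<open>z\<close> removes \<open>R\<close>; since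
      \<open>NB y b\<close> is independent of \<open>a\<close>, each of the \<open>d1\<close> values
      of \<open>a\<close> contributes 1.\<close>
    show "(\<Sum>z\<in>Z. \<Sum>a<d1. \<Sum>b<d2. R a b z * NB y b) = real d1" if "y \<in> Y" for y
    proof -
      have "(\<Sum>b<d2. NB y b) = 1"
        unfolding NB_def using total[OF x0 that] by (subst sum.swap)
      then show ?thesis
        by (simp add: prob_dist_decoded_sum R)
    qed
  qed (use card in auto)
  moreover have "succ_prob X Y f Q \<le> real d2 / real (card Y)"
  proof (rule succ_prob_le_right[OF dcb])
    define NA where "NA x a = (\<Sum>b<d2. N x y0 a b)" for x a
    show "Q x y (f x y) \<le> (\<Sum>a<d1. \<Sum>b<d2. R a b (f x y) * NA x a)" if "x \<in> X" "y \<in> Y" for x y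
    proof -
      have "N x y a b \<le> NA x a" if "a < d1" "b < d2" for a b
      proof -
        have "N x y a b \<le> (\<Sum>b<d2. N x y a b)"
          using nonneg \<open>x \<in> X\<close> \<open>y \<in> Y\<close> that by (intro member_le_sum) auto
        also have "\<dots> = NA x a"
          using N \<open>x \<in> X\<close> \<open>y \<in> Y\<close> y0 that unfolding nonsignaling_def NA_def by blast
        finally show ?thesis .
      qed
      then show ?thesis
        unfolding Q[OF that f[OF that]] using Rnonneg f[OF that]
        by (intro sum_mono mult_left_mono) auto
    qed
    show "(\<Sum>z\<in>Z. \<Sum>a<d1. \<Sum>b<d2. R a b z * NA x a) = real d2" if "x \<in> X" for x
    proof -
      have "(\<Sum>a<d1. NA x a) = 1"
        unfolding NA_def using total[OF that y0] .
      then show ?thesis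
        by (simp add: prob_dist_decoded_sum R flip: sum_distrib_left)
    qed
  qed (use card in auto)
  ultimately show ?thesis
    using card by (simp add: min_def)
qed

section \<open>The bound for quantum messages without entanglement\<close>

lemma mat_trace_mult_minus:
  assumes "T \<in> carrier_mat n n" "A \<in> carrier_mat n n" "B \<in> carrier_mat n n"
  shows "mat_trace (T * (A - B)) = mat_trace (T * A) - mat_trace (T * B)"
proof -
  have "A - B \<in> carrier_mat n n"
    using assms by (intro minus_carrier_mat)
  then show ?thesis
    using assms
    by (simp add: mat_trace_mult[where n = n] sum_subtractf[symmetric] right_diff_distrib)
qed

text \<open>The difference of the two sides pairs \<open>T\<close> with
  \<open>kron (1\<^sub>m m - \<rho>) \<sigma>\<close>, a tensor product of positive
  operators.\<close>

lemma trace_kron_state_le_left: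
  assumes T: "psd (m * n) T" and \<rho>: "state m \<rho>" and \<sigma>: "state n \<sigma>"
  shows "Re (mat_trace (T * kron \<rho> \<sigma>)) \<le> Re (mat_trace (T * kron (1\<^sub>m m) \<sigma>))"
proof -
  have car: "\<rho> \<in> carrier_mat m m" "\<sigma> \<in> carrier_mat n n" "T \<in> carrier_mat (m * n) (m * n)"
    using assms by (auto simp: state_def psd_carrier)
  have diff: "kron (1\<^sub>m m - \<rho>) \<sigma> = kron (1\<^sub>m m) \<sigma> - kron \<rho> \<sigma>"
    using car by (intro eq_matI) (auto simp: kron_def less_mult_imp_div_less algebra_simps)
  have "0 \<le> mat_trace (T * kron (1\<^sub>m m - \<rho>) \<sigma>)"
    using \<sigma> by (intro trace_psd_mult_nonneg[OF T] psd_kron psd_one_minus_state \<rho>)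
      (simp add: state_def)
  also have "\<dots> = mat_trace (T * kron (1\<^sub>m m) \<sigma>) - mat_trace (T * kron \<rho> \<sigma>)"
    unfolding diff using car by (intro mat_trace_mult_minus[where n = "m * n"] kron_carrier) auto
  finally show ?thesis
    by (simp add: nonneg_complex_iff)
qed

lemma trace_kron_state_le_right:
  assumes T: "psd (m * n) T" and \<rho>: "state m \<rho>" and \<sigma>: "state n \<sigma>"
  shows "Re (mat_trace (T * kron \<rho> \<sigma>)) \<le> Re (mat_trace (T * kron \<rho> (1\<^sub>m n)))"
proof -
  have car: "\<rho> \<in> carrier_mat m m" "\<sigma> \<in> carrier_mat n n" "T \<in> carrier_mat (m * n) (m * n)"
    using assms by (auto simp: state_def psd_carrier)
  have mod: "i mod n < n" if "i < m * n" for i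
    using that by (cases n) auto
  have diff: "kron \<rho> (1\<^sub>m n - \<sigma>) = kron \<rho> (1\<^sub>m n) - kron \<rho> \<sigma>"
    using car by (intro eq_matI) (auto simp: kron_def mod algebra_simps)
  have "0 \<le> mat_trace (T * kron \<rho> (1\<^sub>m n - \<sigma>))"
    using \<rho> by (intro trace_psd_mult_nonneg[OF T] psd_kron psd_one_minus_state \<sigma>)
      (simp add: state_def)
  also have "\<dots> = mat_trace (T * kron \<rho> (1\<^sub>m n)) - mat_trace (T * kron \<rho> \<sigma>)"
    unfolding diff using car by (intro mat_trace_mult_minus[where n = "m * n"] kron_carrier) auto
  finally show ?thesis
    by (simp add: nonneg_complex_iff)
qed

lemma mat_trace_one: "mat_trace (1\<^sub>m n) = of_nat n"
  by (simp add: mat_trace_def)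

lemma Q_set_succ_prob_le:
  assumes dcb: "dcb X Y Z f" and card: "card X = n" "card Y = n" "0 < n"
    and Q: "Q \<in> Q_set X Y Z d1 d2"
  shows "succ_prob X Y f Q \<le> real (min d1 d2) / real n"
proof -
  from Q obtain \<rho> \<sigma> T where \<rho>: "\<And>x. x \<in> X \<Longrightarrow> state d1 (\<rho> x)"
    and \<sigma>: "\<And>y. y \<in> Y \<Longrightarrow> state d2 (\<sigma> y)" and T: "povm (d1 * d2) Z T"
    and Q: "\<And>x y z. x \<in> X \<Longrightarrow> y \<in> Y \<Longrightarrow> z \<in> Z \<Longrightarrow>
        complex_of_real (Q x y z) = mat_trace (T z * kron (\<rho> x) (\<sigma> y))"
    unfolding Q_set_def by blast
  have ReQ: "Q x y (f x y) = Re (mat_trace (T (f x y) * kron (\<rho> x) (\<sigma> y)))"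
    and psdT: "psd (d1 * d2) (T (f x y))" if "x \<in> X" "y \<in> Y" for x y
  proof -
    have "f x y \<in> Z"
      using dcb that by (auto simp: dcb_def bij_betw_def)
    then show "Q x y (f x y) = Re (mat_trace (T (f x y) * kron (\<rho> x) (\<sigma> y)))"
      "psd (d1 * d2) (T (f x y))"
      using T Q[OF that, symmetric] by (auto simp: povm_def)
  qed
  have car: "\<And>x. x \<in> X \<Longrightarrow> \<rho> x \<in> carrier_mat d1 d1" "\<And>y. y \<in> Y \<Longrightarrow> \<sigma> y \<in> carrier_mat d2 d2"
    using \<rho> \<sigma> by (auto simp: state_def psd_carrier)
  have "succ_prob X Y f Q \<le> real d1 / real (card X)"
  proof (rule succ_prob_le_left[OF dcb])
    show "Q x y (f x y) \<le> Re (mat_trace (T (f x y) * kron (1\<^sub>m d1) (\<sigma> y)))"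
      if "x \<in> X" "y \<in> Y" for x y
      unfolding ReQ[OF that] using that by (intro trace_kron_state_le_left[where n = d2] psdT \<rho> \<sigma>)
    \<comment> \<open>The weight is the trace of \<open>kron (1\<^sub>m d1) (\<sigma> y)\<close>,
      that is \<open>d1\<close> times 1.\<close>
    show "(\<Sum>z\<in>Z. Re (mat_trace (T z * kron (1\<^sub>m d1) (\<sigma> y)))) = real d1" if "y \<in> Y" for y
    proof -
      have "(\<Sum>z\<in>Z. mat_trace (T z * kron (1\<^sub>m d1) (\<sigma> y))) = of_nat d1 * 1"
        using car(2)[OF that] \<sigma>[OF that]
        by (simp add: povm_trace_sum[OF T] kron_carrier mat_trace_kron[where m = d1 and n = d2]
            mat_trace_one state_def)
      then show ?thesis
        by (simp flip: Re_sum)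
    qed
  qed (use card in auto)
  moreover have "succ_prob X Y f Q \<le> real d2 / real (card Y)"
  proof (rule succ_prob_le_right[OF dcb])
    show "Q x y (f x y) \<le> Re (mat_trace (T (f x y) * kron (\<rho> x) (1\<^sub>m d2)))"
      if "x \<in> X" "y \<in> Y" for x y
      unfolding ReQ[OF that] using that by (intro trace_kron_state_le_right[where m = d1] psdT \<rho> \<sigma>)
    show "(\<Sum>z\<in>Z. Re (mat_trace (T z * kron (\<rho> x) (1\<^sub>m d2)))) = real d2" if "x \<in> X" for x
    proof -
      have "(\<Sum>z\<in>Z. mat_trace (T z * kron (\<rho> x) (1\<^sub>m d2))) = 1 * of_nat d2"
        using car(1)[OF that] \<rho>[OF that]
        by (simp add: povm_trace_sum[OF T] kron_carrier mat_trace_kron[where m = d1 and n = d2]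
            mat_trace_one state_def)
      then show ?thesis
        by (simp flip: Re_sum)
    qed
  qed (use card in auto)
  ultimately show ?thesis
    using card by (simp add: min_def)
qed

text \<open>The channels send the shared state to a state, on which the measurement has total
  probability 1. This also supplies the boundedness that the real supremum requires.\<close>

lemma QE_set_succ_prob_le_1:
  assumes dcb: "dcb X Y Z f" and Q: "Q \<in> QE_set X Y Z d1 d2"
  shows "succ_prob X Y f Q \<le> 1"
proof -
  from Q obtain nA nB \<rho> E F T where \<rho>: "state (nA * nB) \<rho>"
    and E: "\<And>x. x \<in> X \<Longrightarrow> channel nA d1 (E x)" and F: "\<And>y. y \<in> Y \<Longrightarrow> channel nB d2 (F y)"
    and T: "povm (d1 * d2) Z T"
    and Q: "\<And>x y z. x \<in> X \<Longrightarrow> y \<in> Y \<Longrightarrow> z \<in> Z \<Longrightarrow>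
        complex_of_real (Q x y z) = mat_trace (T z * map_tensor nA d1 nB d2 (E x) (F y) \<rho>)"
    unfolding QE_set_def by blast
  have "Q x y (f x y) \<le> 1" if xy: "x \<in> X" "y \<in> Y" for x y
  proof -
    define \<tau> where "\<tau> = map_tensor nA d1 nB d2 (E x) (F y) \<rho>"
    have \<tau>: "state (d1 * d2) \<tau>"
      unfolding \<tau>_def by (intro state_map_tensor \<rho> E F xy)
    have nonneg: "0 \<le> Q x y z" if "z \<in> Z" for z
    proof -
      have "0 \<le> complex_of_real (Q x y z)"
        unfolding Q[OF xy that] \<tau>_def[symmetric] using T \<tau> that
        by (intro trace_psd_mult_nonneg) (auto simp: povm_def state_def)
      then show ?thesis by (simp add: nonneg_complex_iff)
    qed
    have "f x y \<in> Z" "finite Z"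
      using dcb xy by (auto simp: dcb_def bij_betw_def)
    then have "Q x y (f x y) \<le> (\<Sum>z\<in>Z. Q x y z)"
      using nonneg by (intro member_le_sum) auto
    also have "complex_of_real (\<Sum>z\<in>Z. Q x y z) = (\<Sum>z\<in>Z. mat_trace (T z * \<tau>))"
      unfolding of_real_sum \<tau>_def by (intro sum.cong refl Q xy)
    then have "(\<Sum>z\<in>Z. Q x y z) = 1"
      using povm_trace_sum[OF T, of \<tau>] \<tau> unfolding state_def
      by (metis of_real_eq_1_iff psd_carrier)
    finally show ?thesis .
  qed
  then have "(\<Sum>x\<in>X. \<Sum>y\<in>Y. Q x y (f x y)) \<le> (\<Sum>x\<in>X. \<Sum>y\<in>Y. 1)"
    by (intro sum_mono)
  \<comment> \<open>For an empty alphabet the quotient has denominator 0 and its value is 0.\<close>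
  then show ?thesis
    unfolding succ_prob_def
    by (cases "card X = 0 \<or> card Y = 0") (auto simp: divide_le_eq_1 zero_less_mult_iff)
qed

subsection \<open>Dense coding\<close>

text \<open>A left inverse of a square matrix is a right inverse. This gives both the completeness
  of an orthonormal family and the passage to a transposed unitary.\<close>

lemma orthonormal_columns_imp_rows:
  fixes A :: "nat \<Rightarrow> nat \<Rightarrow> complex"
  assumes cols: "\<And>i j. i < n \<Longrightarrow> j < n \<Longrightarrow> (\<Sum>r<n. cnj (A r i) * A r j) = (if i = j then 1 else 0)"
    and "i < n" "j < n"
  shows "(\<Sum>c<n. A i c * cnj (A j c)) = (if i = j then 1 else 0)"
proof -
  define M where "M = mat n n (\<lambda>(i, j). A i j)"
  define M' where "M' = mat n n (\<lambda>(i, j). cnj (A j i))"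
  have car: "M' \<in> carrier_mat n n" "M \<in> carrier_mat n n"
    by (auto simp: M_def M'_def)
  have "M' * M = 1\<^sub>m n"
    by (rule eq_matI) (auto simp: M_def M'_def scalar_prod_def atLeast0LessThan cols)
  then have "M * M' = 1\<^sub>m n"
    by (rule mat_mult_left_right_inverse[OF car])
  then have "(M * M') $$ (i, j) = 1\<^sub>m n $$ (i, j)" by simp
  with assms(2,3) show ?thesis
    by (auto simp: M_def M'_def scalar_prod_def atLeast0LessThan)
qed

lemma psd_add:
  assumes "psd n A" "psd n B"
  shows "psd n (A + B)"
proof (rule psdI)
  show "A + B \<in> carrier_mat n n"
    using assms by (auto simp: psd_carrier)
  fix v :: "nat \<Rightarrow> complex"
  have "(\<Sum>i<n. \<Sum>j<n. (A + B) $$ (i, j) * v j * cnj (v i))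
      = (\<Sum>i<n. \<Sum>j<n. A $$ (i, j) * v j * cnj (v i)) + (\<Sum>i<n. \<Sum>j<n. B $$ (i, j) * v j * cnj (v i))"
    unfolding sum.distrib[symmetric] using assms[THEN psd_carrier]
    by (intro sum.cong refl) (auto simp: distrib_right)
  then show "0 \<le> (\<Sum>i<n. \<Sum>j<n. (A + B) $$ (i, j) * v j * cnj (v i))"
    using assms[THEN psd_quad_form_nonneg, of v] by simp
qed

text \<open>Acting with \<open>UA x\<close> and the transpose of \<open>UB y\<close> on the two halves of the maximally entangled
  state produces the vector with entries \<open>(UA x * UB y) $$ (r, s) / sqrt d\<close>, which is \<open>W (f x y)\<close> up to
  a phase; the vectors \<open>W z\<close> form an orthonormal basis.\<close>

lemma dense_coding:
  fixes UA :: "'x \<Rightarrow> nat \<Rightarrow> nat \<Rightarrow> complex" and UB :: "'y \<Rightarrow> nat \<Rightarrow> nat \<Rightarrow> complex"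
    and W :: "'z \<Rightarrow> nat \<Rightarrow> nat \<Rightarrow> complex"
  assumes dcb: "dcb X Y Z f" and card: "card X > 0" "card Y > 0" "card Z = d\<^sup>2"
    and d: "0 < d" "d \<le> d1" "d \<le> d2"
    and UA: "\<And>x i j. x \<in> X \<Longrightarrow> i < d \<Longrightarrow> j < d \<Longrightarrow>
      (\<Sum>r<d. cnj (UA x r i) * UA x r j) = (if i = j then 1 else 0)"
    and UB: "\<And>y i j. y \<in> Y \<Longrightarrow> i < d \<Longrightarrow> j < d \<Longrightarrow>
      (\<Sum>r<d. cnj (UB y r i) * UB y r j) = (if i = j then 1 else 0)"
    and W: "\<And>z z'. z \<in> Z \<Longrightarrow> z' \<in> Z \<Longrightarrow>
      (\<Sum>r<d. \<Sum>s<d. cnj (W z r s) * W z' r s) = (if z = z' then of_nat d else 0)"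
    and mult: "\<And>x y. x \<in> X \<Longrightarrow> y \<in> Y \<Longrightarrow> \<exists>\<omega>. cmod \<omega> = 1 \<and>
      (\<forall>r<d. \<forall>s<d. (\<Sum>i<d. UA x r i * UB y i s) = \<omega> * W (f x y) r s)"
  shows "\<exists>Q\<in>QE_set X Y Z d1 d2. succ_prob X Y f Q = 1"
proof -
  define n where "n = d1 * d2"
  \<comment> \<open>The protocol lives in the \<open>d\<close> by \<open>d\<close> corner of the
    \<open>d1 * d2\<close> dimensional product space; \<open>in_range\<close> marks the basis
    indices of the corner.\<close>
  define in_range where "in_range p \<longleftrightarrow> p div d2 < d \<and> p mod d2 < d" for p
  define sd where "sd = complex_of_real (sqrt (real d))"
  have sd: "sd * sd = of_nat d" "cnj sd = sd" "sd \<noteq> 0"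
    using d by (auto simp: sd_def simp flip: of_real_mult)
  define w where "w z p = (if in_range p then W z (p div d2) (p mod d2) / sd else 0)" for z p
  have fZ: "f x y \<in> Z" if "x \<in> X" "y \<in> Y" for x y
    using dcb that by (auto simp: dcb_def bij_betw_def)
  have finZ: "finite Z"
    using dcb by (simp add: dcb_def)
  obtain z0 where z0: "z0 \<in> Z"
    using card d finZ by fastforce

  have in_range_sum: "(\<Sum>p<n. if in_range p then g (p div d2) (p mod d2) else 0)
      = (\<Sum>r<d. \<Sum>s<d. g r s)" for g :: "nat \<Rightarrow> nat \<Rightarrow> complex"
  proof -
    have "(\<Sum>p<n. if in_range p then g (p div d2) (p mod d2) else 0)
        = (\<Sum>r<d1. \<Sum>s<d2. if r < d then if s < d then g r s else 0 else 0)"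
      unfolding n_def sum_lessThan_mult by (intro sum.cong refl) (auto simp: in_range_def)
    also have "\<dots> = (\<Sum>r<d1. if r < d then \<Sum>s<d2. if s < d then g r s else 0 else 0)"
      by (intro sum.cong refl) auto
    also have "\<dots> = (\<Sum>r\<in>{..<d1} \<inter> {..<d}. \<Sum>s\<in>{..<d2} \<inter> {..<d}. g r s)"
      by (simp add: sum.inter_restrict)
    also have "\<dots> = (\<Sum>r<d. \<Sum>s<d. g r s)"
      using d by (simp add: Int_absorb1)
    finally show ?thesis .
  qed

  have w_norm: "(\<Sum>p<n. w z p * cnj (w z p)) = 1" if "z \<in> Z" for z
  proof -
    have "(\<Sum>p<n. w z p * cnj (w z p)) = (\<Sum>p<n. if in_range p then
        (\<lambda>r s. cnj (W z r s) * W z r s / of_nat d) (p div d2) (p mod d2) else 0)"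
      by (intro sum.cong refl) (simp add: w_def sd)
    also have "\<dots> = (\<Sum>r<d. \<Sum>s<d. cnj (W z r s) * W z r s / of_nat d)"
      by (rule in_range_sum)
    also have "\<dots> = 1"
      using W[OF that that] d by (simp flip: sum_divide_distrib)
    finally show ?thesis .
  qed

  \<comment> \<open>With the normalised \<open>W (e k)\<close> as columns the matrix is square
    because \<open>card Z\<close> is \<open>d * d\<close>; orthonormality of its rows is the
    completeness relation.\<close>
  have complete: "(\<Sum>z\<in>Z. W z r s * cnj (W z r' s')) = (if r = r' \<and> s = s' then of_nat d else 0)"
    if less: "r < d" "s < d" "r' < d" "s' < d" for r s r' s'
  proof -
    obtain e where e: "bij_betw e {..<d * d} Z"
      using ex_bij_betw_nat_finite[OF finZ] card by (auto simp: power2_eq_square atLeast0LessThan)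
    define A where "A p k = W (e k) (p div d) (p mod d) / sd" for p k
    have eZ: "e k \<in> Z" if "k < d * d" for k
      using e that by (auto simp: bij_betw_def)
    have "(\<Sum>p<d * d. cnj (A p i) * A p j) = (if i = j then 1 else 0)"
      if ij: "i < d * d" "j < d * d" for i j
    proof -
      have "(\<Sum>p<d * d. cnj (A p i) * A p j) = (\<Sum>r<d. \<Sum>s<d. cnj (W (e i) r s) * W (e j) r s / of_nat d)"
        unfolding sum_lessThan_mult by (intro sum.cong refl) (auto simp: A_def sd)
      also have "\<dots> = (if e i = e j then 1 else 0)"
        using W[OF eZ[OF ij(1)] eZ[OF ij(2)]] d by (simp flip: sum_divide_distrib)
      also have "\<dots> = (if i = j then 1 else 0)"
        using e ij by (auto simp: bij_betw_def inj_on_def)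
      finally show ?thesis .
    qed
    note rows = orthonormal_columns_imp_rows[of "d * d" A, OF this]
    have "(\<Sum>z\<in>Z. W z r s * cnj (W z r' s')) = (\<Sum>k<d * d. W (e k) r s * cnj (W (e k) r' s'))"
      by (rule sum.reindex_bij_betw[OF e, symmetric])
    also have "\<dots> = of_nat d * (\<Sum>k<d * d. A (r * d + s) k * cnj (A (r' * d + s') k))"
      unfolding sum_distrib_left using less
      by (intro sum.cong refl) (simp add: A_def sd d)
    also have "\<dots> = of_nat d * (if r * d + s = r' * d + s' then 1 else 0)"
      using less by (subst rows) (auto simp: pair_index_less)
    also have "r * d + s = r' * d + s' \<longleftrightarrow> r = r' \<and> s = s'"
    proof
      assume "r * d + s = r' * d + s'"
      then have "(r * d + s) div d = (r' * d + s') div d" "(r * d + s) mod d = (r' * d + s') mod d"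
        by simp_all
      then show "r = r' \<and> s = s'" using less by simp
    qed auto
    finally show ?thesis by simp
  qed

  \<comment> \<open>All \<open>w z\<close> vanish outside the corner, so the missing part of the
    identity is assigned to an arbitrary outcome \<open>z0\<close>.\<close>
  define T where "T z = mat n n (\<lambda>(p, q). w z p * cnj (w z q)) +
      diag_real n (\<lambda>p. if z = z0 \<and> \<not> in_range p then 1 else 0)" for z
  have T_index: "T z $$ (p, q) = w z p * cnj (w z q) +
      (if p = q \<and> z = z0 \<and> \<not> in_range p then 1 else 0)" if "p < n" "q < n" for z p q
    using that by (simp add: T_def diag_real_def)
  have povm: "povm n Z T"
    unfolding povm_def
  proof (intro conjI ballI allI impI)
    fix z
    have "psd n (mat n n (\<lambda>(p, q). w z p * cnj (w z q)))"
      by (rule psd_gramI[where P = "{()}" and B = "\<lambda>_. w z"]) auto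
    then show "psd n (T z)"
      unfolding T_def by (intro psd_add psd_diag_real) auto
  next
    fix p q assume pq: "p < n" "q < n"
    have "(\<Sum>z\<in>Z. T z $$ (p, q)) = (\<Sum>z\<in>Z. w z p * cnj (w z q)) +
        (\<Sum>z\<in>Z. if z = z0 then if p = q \<and> \<not> in_range p then 1 else 0 else 0)"
      unfolding sum.distrib[symmetric] using pq by (intro sum.cong refl) (auto simp: T_index)
    also have "(\<Sum>z\<in>Z. if z = z0 then if p = q \<and> \<not> in_range p then 1 else 0 else 0)
        = (if p = q \<and> \<not> in_range p then 1 else (0::complex))"
      using z0 finZ by simp
    also have "(\<Sum>z\<in>Z. w z p * cnj (w z q)) = (if p = q \<and> in_range p then 1 else 0)"
    proof (cases "in_range p \<and> in_range q")
      case True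
      then have "(\<Sum>z\<in>Z. w z p * cnj (w z q)) = (\<Sum>z\<in>Z.
          W z (p div d2) (p mod d2) * cnj (W z (q div d2) (q mod d2))) / of_nat d"
        unfolding sum_divide_distrib by (intro sum.cong refl) (simp add: w_def sd)
      also have "\<dots> = (if p div d2 = q div d2 \<and> p mod d2 = q mod d2 then 1 else 0)"
        using True d by (subst complete) (auto simp: in_range_def)
      also have "p div d2 = q div d2 \<and> p mod d2 = q mod d2 \<longleftrightarrow> p = q"
        by (metis div_mult_mod_eq)
      finally show ?thesis using True by simp
    next
      case False
      then show ?thesis by (auto simp: w_def)
    qed
    finally show "(\<Sum>z\<in>Z. T z $$ (p, q)) = 1\<^sub>m n $$ (p, q)"
      using pq by auto
  qed

  define VA where "VA x r i = (if r < d then UA x r i else 0)" for x r i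
  define VB where "VB y s k = (if s < d then UB y k s else 0)" for y s k
  define E where "E x = conj_map d d1 (VA x)" for x
  define F where "F y = conj_map d d2 (VB y)" for y
  have restrict: "(\<Sum>r<m. if r < d then g r else 0) = (\<Sum>r<d. g r)" if "d \<le> m"
    for m and g :: "nat \<Rightarrow> complex"
    using that by (simp add: sum.inter_restrict[symmetric] Int_absorb1 lessThan_def[symmetric]
        flip: lessThan_iff)
  have E: "channel d d1 (E x)" if "x \<in> X" for x
    unfolding E_def
  proof (rule channel_conj_map)
    fix i j assume ij: "i < d" "j < d"
    have "(\<Sum>r<d1. VA x r i * cnj (VA x r j)) = (\<Sum>r<d1. if r < d then cnj (UA x r j) * UA x r i else 0)"
      by (intro sum.cong refl) (simp add: VA_def)
    then show "(\<Sum>r<d1. VA x r i * cnj (VA x r j)) = (if i = j then 1 else 0)"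
      using UA[OF that ij(2,1)] restrict[OF d(2)] by auto
  qed
  \<comment> \<open>Because of the transposition, the isometry condition concerns the rows of
    \<open>UB y\<close>, whereas the hypothesis speaks of its columns.\<close>
  have F: "channel d d2 (F y)" if "y \<in> Y" for y
    unfolding F_def
  proof (rule channel_conj_map)
    fix i j assume ij: "i < d" "j < d"
    have "(\<Sum>r<d2. VB y r i * cnj (VB y r j)) = (\<Sum>r<d2. if r < d then UB y i r * cnj (UB y j r) else 0)"
      by (intro sum.cong refl) (simp add: VB_def)
    then show "(\<Sum>r<d2. VB y r i * cnj (VB y r j)) = (if i = j then 1 else 0)"
      using orthonormal_columns_imp_rows[of d "UB y", OF UB[OF that] ij] restrict[OF d(3)] by auto
  qed

  define \<Phi> where "\<Phi> = mat (d * d) (d * d)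
    (\<lambda>(p, q). if p div d = p mod d \<and> q div d = q mod d then 1 / of_nat d else (0::complex))"
  have \<Phi>: "state (d * d) \<Phi>"
    unfolding state_def
  proof
    show "psd (d * d) \<Phi>"
      by (rule psd_gramI[where P = "{()}" and B = "\<lambda>_ p. if p div d = p mod d then 1 / sd else 0"])
        (auto simp: \<Phi>_def sd)
    have "mat_trace \<Phi> = (\<Sum>p<d * d. if p div d = p mod d then 1 / of_nat d else 0)"
      by (auto simp: mat_trace_def \<Phi>_def)
    also have "\<dots> = (\<Sum>i<d. \<Sum>k<d. if k = i then 1 / of_nat d else 0)"
      unfolding sum_lessThan_mult by (intro sum.cong refl) auto
    also have "\<dots> = 1"
      using d by simp
    finally show "mat_trace \<Phi> = 1" .
  qed

  define \<tau> where "\<tau> x y = map_tensor d d1 d d2 (E x) (F y) \<Phi>" for x y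
  have \<tau>_index: "\<tau> x y $$ (p, q) = w (f x y) p * cnj (w (f x y) q)"
    if xy: "x \<in> X" "y \<in> Y" and pq: "p < n" "q < n" for x y p q
  proof -
    have "0 < d2" using d by simp
    define r r' s s' where "r = p div d2" "r' = p mod d2" "s = q div d2" "s' = q mod d2"
    have less: "r < d1" "s < d1" "r' < d2" "s' < d2"
      using pq \<open>0 < d2\<close> by (auto simp: r_r'_s_s'_def n_def less_mult_imp_div_less)
    obtain \<omega> where \<omega>: "cmod \<omega> = 1"
      "\<And>r s. r < d \<Longrightarrow> s < d \<Longrightarrow> (\<Sum>i<d. UA x r i * UB y i s) = \<omega> * W (f x y) r s"
      using mult[OF xy] by blast
    \<comment> \<open>\<open>sd\<close> undoes the normalisation in \<open>w\<close>; its square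
      will cancel against the weight \<open>1 / d\<close> of \<open>\<Phi>\<close>, and the phase
      \<open>\<omega>\<close> against its conjugate.\<close>
    have amp: "(\<Sum>i<d. VA x r i * VB y r' i) = \<omega> * sd * w (f x y) (r * d2 + r')"
      if "r' < d2" for r r'
      using \<omega>(2) that sd(3) by (simp add: VA_def VB_def w_def in_range_def)
    have "\<tau> x y $$ (p, q) = \<tau> x y $$ (r * d2 + r', s * d2 + s')"
      by (simp add: r_r'_s_s'_def)
    also have "\<dots> = (\<Sum>i<d. \<Sum>j<d. \<Sum>k<d. \<Sum>l<d. \<Phi> $$ (i * d + k, j * d + l) *
        (E x (mat_elem d i j) $$ (r, s) * F y (mat_elem d k l) $$ (r', s')))"
      unfolding \<tau>_def using less
      by (intro map_tensor_pair_index) (auto simp: E_def F_def conj_map_def)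
    also have "\<dots> = (\<Sum>i<d. \<Sum>j<d. \<Sum>k<d. \<Sum>l<d. if l = j then if k = i then
        (VA x r i * VB y r' i) * cnj (VA x s j * VB y s' j) / of_nat d else 0 else 0)"
      by (intro sum.cong refl)
        (use less in \<open>auto simp: \<Phi>_def pair_index_less E_def F_def conj_map_mat_elem\<close>)
    also have "\<dots> = (\<Sum>i<d. \<Sum>j<d. (VA x r i * VB y r' i) * cnj (VA x s j * VB y s' j) / of_nat d)"
      by simp
    also have "\<dots> = (\<Sum>i<d. VA x r i * VB y r' i) * cnj (\<Sum>j<d. VA x s j * VB y s' j) / of_nat d"
      unfolding cnj_sum sum_product sum_divide_distrib ..
    also have "\<dots> = (\<omega> * cnj \<omega>) * (w (f x y) p * cnj (w (f x y) q)) * (sd * sd / of_nat d)"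
      unfolding amp[OF less(3)] amp[OF less(4)] by (simp add: r_r'_s_s'_def sd(2) mult_ac)
    also have "sd * sd / of_nat d = 1"
      using d by (simp add: sd(1))
    also have "\<omega> * cnj \<omega> = 1"
      using \<omega>(1) by (simp flip: complex_norm_square)
    finally show ?thesis unfolding mult_1_left mult_1_right .
  qed
  have \<tau>: "state n (\<tau> x y)" if "x \<in> X" "y \<in> Y" for x y
    unfolding \<tau>_def n_def using that by (intro state_map_tensor \<Phi> E F)

  define Q where "Q x y z = Re (mat_trace (T z * \<tau> x y))" for x y z
  have "complex_of_real (Q x y z) = mat_trace (T z * \<tau> x y)" if "x \<in> X" "y \<in> Y" "z \<in> Z" for x y z
  proof -
    have "0 \<le> mat_trace (T z * \<tau> x y)"
      using povm \<tau> that by (intro trace_psd_mult_nonneg[of n]) (auto simp: povm_def state_def)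
    then show ?thesis
      by (simp add: Q_def nonneg_complex_iff complex_eq_iff)
  qed
  then have "Q \<in> QE_set X Y Z d1 d2"
    unfolding QE_set_def \<tau>_def using \<Phi> E F povm[unfolded n_def] by blast
  moreover have "Q x y (f x y) = 1" if xy: "x \<in> X" "y \<in> Y" for x y
  proof -
    let ?z = "f x y"
    have car: "T ?z \<in> carrier_mat n n" "\<tau> x y \<in> carrier_mat n n"
      using \<tau>[OF xy] by (auto simp: T_def diag_real_def state_def psd_carrier)
    have "mat_trace (T ?z * \<tau> x y)
        = (\<Sum>p<n. \<Sum>q<n. T ?z $$ (p, q) * \<tau> x y $$ (q, p))"
      using car by (rule mat_trace_mult)
    \<comment> \<open>The diagonal supplement of \<open>T\<close> only meets entries of
      \<open>\<tau>\<close> outside the corner, and those are 0.\<close>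
    also have "\<dots> = (\<Sum>p<n. \<Sum>q<n. (w ?z p * cnj (w ?z p)) * (w ?z q * cnj (w ?z q)))"
      by (intro sum.cong refl) (auto simp: T_index \<tau>_index xy w_def)
    also have "\<dots> = 1"
      unfolding sum_product[symmetric] w_norm[OF fZ[OF xy]] by simp
    finally show ?thesis by (simp add: Q_def)
  qed
  then have "succ_prob X Y f Q = 1"
    using card by (simp add: succ_prob_def)
  ultimately show ?thesis by blast
qed

section \<open>From projective representations to dense coding\<close>

lemma mat_adjoint_index:
  assumes "A \<in> carrier_mat n n" "i < n" "j < n"
  shows "mat_adjoint A $$ (i, j) = cnj (A $$ (j, i))"
  using assms by (simp add: mat_adjoint_def mat_of_rows_index)

lemma mat_adjoint_carrier: "A \<in> carrier_mat n n \<Longrightarrow> mat_adjoint A \<in> carrier_mat n n"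
  by (auto simp: mat_adjoint_def)

lemma mat_mult_index_sum:
  "A \<in> carrier_mat n n \<Longrightarrow> B \<in> carrier_mat n n \<Longrightarrow> i < n \<Longrightarrow> j < n \<Longrightarrow>
   (A * B) $$ (i, j) = (\<Sum>k<n. A $$ (i, k) * B $$ (k, j))"
  by (auto simp: scalar_prod_def atLeast0LessThan)

lemma unitary_mat_columns:
  assumes "unitary_mat n U" "i < n" "j < n"
  shows "(\<Sum>r<n. cnj (U $$ (r, i)) * U $$ (r, j)) = (if i = j then 1 else 0)"
proof -
  have car: "U \<in> carrier_mat n n" and "mat_adjoint U * U = 1\<^sub>m n"
    using assms by (auto simp: unitary_mat_def)
  then have "(mat_adjoint U * U) $$ (i, j) = (if i = j then 1 else 0)"
    using assms by simp
  then show ?thesis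
    using assms(2,3) car
    by (simp add: mat_mult_index_sum[where n = n] mat_adjoint_carrier mat_adjoint_index[where n = n]
        del: index_mult_mat)
qed

text \<open>The representation is pulled back along the three identifications of alphabets with the
  group, which yields three different families of matrices.\<close>

lemma tnc_QE_set:
  assumes tnc: "tnc d G" and table: "group_table G X Y Z f" and dcb: "dcb X Y Z f"
    and d: "0 < d" "d \<le> d1" "d \<le> d2"
  shows "\<exists>Q\<in>QE_set X Y Z d1 d2. succ_prob X Y f Q = 1"
proof -
  from tnc obtain U and \<omega> :: "_ \<Rightarrow> _ \<Rightarrow> complex" where G: "card (carrier G) = d\<^sup>2"
    and unitary: "\<And>g. g \<in> carrier G \<Longrightarrow> unitary_mat d (U g)"
    and orth: "\<And>g h. g \<in> carrier G \<Longrightarrow> h \<in> carrier G \<Longrightarrow>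
      mat_trace (mat_adjoint (U g) * U h) = (if g = h then of_nat d else 0)"
    and mult: "\<And>g h. g \<in> carrier G \<Longrightarrow> h \<in> carrier G \<Longrightarrow>
      cmod (\<omega> g h) = 1 \<and> U g * U h = \<omega> g h \<cdot>\<^sub>m U (g \<otimes>\<^bsub>G\<^esub> h)"
    unfolding tnc_def by blast
  from table obtain \<phi> \<psi> \<chi> where bij: "bij_betw \<phi> X (carrier G)" "bij_betw \<psi> Y (carrier G)"
      "bij_betw \<chi> Z (carrier G)"
    and hom: "\<And>x y. x \<in> X \<Longrightarrow> y \<in> Y \<Longrightarrow> \<chi> (f x y) = \<phi> x \<otimes>\<^bsub>G\<^esub> \<psi> y"
    unfolding group_table_def by blast
  note into = bij[THEN bij_betwE, rule_format]
  have car: "U g \<in> carrier_mat d d" if "g \<in> carrier G" for g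
    using unitary[OF that] by (simp add: unitary_mat_def)
  note card = bij[THEN bij_betw_same_card, unfolded G]
  show ?thesis
  proof (rule dense_coding[OF dcb _ _ card(3) d, where UA = "\<lambda>x i j. U (\<phi> x) $$ (i, j)"
        and UB = "\<lambda>y i j. U (\<psi> y) $$ (i, j)" and W = "\<lambda>z i j. U (\<chi> z) $$ (i, j)"])
    show "0 < card X" "0 < card Y"
      using card d by auto
    show "(\<Sum>r<d. cnj (U (\<phi> x) $$ (r, i)) * U (\<phi> x) $$ (r, j)) = (if i = j then 1 else 0)"
      if "x \<in> X" "i < d" "j < d" for x i j
      using that into by (intro unitary_mat_columns unitary)
    show "(\<Sum>r<d. cnj (U (\<psi> y) $$ (r, i)) * U (\<psi> y) $$ (r, j)) = (if i = j then 1 else 0)"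
      if "y \<in> Y" "i < d" "j < d" for y i j
      using that into by (intro unitary_mat_columns unitary)
    show "(\<Sum>r<d. \<Sum>s<d. cnj (U (\<chi> z) $$ (r, s)) * U (\<chi> z') $$ (r, s))
        = (if z = z' then of_nat d else 0)" if "z \<in> Z" "z' \<in> Z" for z z'
    proof -
      have zz: "\<chi> z \<in> carrier G" "\<chi> z' \<in> carrier G"
        using that into by auto
      have "(\<Sum>r<d. \<Sum>s<d. cnj (U (\<chi> z) $$ (r, s)) * U (\<chi> z') $$ (r, s))
          = (\<Sum>s<d. \<Sum>r<d. mat_adjoint (U (\<chi> z)) $$ (s, r) * U (\<chi> z') $$ (r, s))"
        using car[OF zz(1)] by (subst sum.swap) (simp add: mat_adjoint_index[where n = d])
      also have "\<dots> = mat_trace (mat_adjoint (U (\<chi> z)) * U (\<chi> z'))"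
        using zz by (intro mat_trace_mult[symmetric] mat_adjoint_carrier car)
      also have "\<dots> = (if z = z' then of_nat d else 0)"
        unfolding orth[OF zz] using bij(3) that by (auto simp: bij_betw_def inj_on_def)
      finally show ?thesis .
    qed
    show "\<exists>\<omega>. cmod \<omega> = 1 \<and> (\<forall>r<d. \<forall>s<d. (\<Sum>i<d. U (\<phi> x) $$ (r, i) * U (\<psi> y) $$ (i, s))
        = \<omega> * U (\<chi> (f x y)) $$ (r, s))" if xy: "x \<in> X" "y \<in> Y" for x y
    proof (intro exI conjI allI impI)
      have g: "\<phi> x \<in> carrier G" "\<psi> y \<in> carrier G"
        using that into by auto
      then show "cmod (\<omega> (\<phi> x) (\<psi> y)) = 1"
        using mult by blast
      fix r s assume rs: "r < d" "s < d"
      have "\<phi> x \<otimes>\<^bsub>G\<^esub> \<psi> y \<in> carrier G"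
        using tnc g by (auto simp: tnc_def group_def monoid.m_closed)
      from car[OF this] have "(\<omega> (\<phi> x) (\<psi> y) \<cdot>\<^sub>m U (\<phi> x \<otimes>\<^bsub>G\<^esub> \<psi> y)) $$ (r, s)
          = \<omega> (\<phi> x) (\<psi> y) * U (\<phi> x \<otimes>\<^bsub>G\<^esub> \<psi> y) $$ (r, s)"
        using rs by simp
      then show "(\<Sum>i<d. U (\<phi> x) $$ (r, i) * U (\<psi> y) $$ (i, s))
          = \<omega> (\<phi> x) (\<psi> y) * U (\<chi> (f x y)) $$ (r, s)"
        using mult[OF g] mat_mult_index_sum[OF car[OF g(1)] car[OF g(2)] rs] hom[OF xy] by simp
    qed
  qed
qed

subsection \<open>Addition modulo \<open>d\<close> in two coordinates\<close>

lemma card_Zd2: "card (Zd2 d) = d\<^sup>2"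
  by (simp add: Zd2_def power2_eq_square)

lemma finite_Zd2: "finite (Zd2 d)"
  by (simp add: Zd2_def)

lemma mod_add_left_inject:
  "q < d \<Longrightarrow> q' < d \<Longrightarrow> (j + q) mod d = (j + q') mod d \<longleftrightarrow> q = (q' :: nat)"
  by (metis cong_def cong_add_lcancel_nat mod_less)

lemma dcb_add_Zd2:
  assumes "0 < d"
  shows "dcb (Zd2 d) (Zd2 d) (Zd2 d) (add_Zd2 d)"
proof -
  have range: "add_Zd2 d x y \<in> Zd2 d" for x y
    using assms by (auto simp: add_Zd2_def Zd2_def split: prod.splits)
  have inj: "inj_on (add_Zd2 d x) (Zd2 d)" for x
    by (cases x) (auto simp: inj_on_def add_Zd2_def Zd2_def mod_add_left_inject)
  have bij: "bij_betw (add_Zd2 d x) (Zd2 d) (Zd2 d)" for x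
    unfolding bij_betw_def using inj range finite_Zd2
    by (intro conjI endo_inj_surj) (blast intro: inj range finite_Zd2)+
  have comm: "add_Zd2 d x y = add_Zd2 d y x" for x y
    by (cases x, cases y) (simp add: add_Zd2_def add.commute)
  have "(\<lambda>x. add_Zd2 d x y) = add_Zd2 d y" for y
    by (rule ext) (rule comm)
  then show ?thesis
    using bij finite_Zd2 by (simp add: dcb_def)
qed

text \<open>The generalised Pauli operators (shift by \<open>q\<close>, clock to the power \<open>r\<close>) represent \<open>Zd2 d\<close>
  projectively.\<close>

lemma Zd2_QE_set:
  assumes d: "0 < d" "d \<le> d1" "d \<le> d2"
  shows "\<exists>Q\<in>QE_set (Zd2 d) (Zd2 d) (Zd2 d) d1 d2. succ_prob (Zd2 d) (Zd2 d) (add_Zd2 d) Q = 1"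
proof -
  define \<zeta> where "\<zeta> = cis (2 * pi / real d)"
  have \<zeta>_pow: "\<zeta> ^ k = cis (2 * pi * real k / real d)" for k
    by (simp add: \<zeta>_def DeMoivre mult_ac)
  have \<zeta>_d: "\<zeta> ^ d = 1"
    using d by (simp add: \<zeta>_pow)
  have \<zeta>_inj: "r = r'" if "r < d" "r' < d" "\<zeta> ^ r = \<zeta> ^ r'" for r r'
    using bij_betw_roots_unity[OF d(1)] that by (auto simp: \<zeta>_pow bij_betw_def inj_on_def)
  have \<zeta>_cnj: "\<zeta> ^ k * cnj (\<zeta> ^ k) = 1" for k
    by (simp add: \<zeta>_pow flip: complex_norm_square)
  have pow_mod: "x ^ (m mod d) = x ^ m" if "x ^ d = 1" for x :: complex and m
  proof -
    have "x ^ m = x ^ (d * (m div d) + m mod d)" by simp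
    also have "\<dots> = x ^ (m mod d)"
      unfolding power_add power_mult that by simp
    finally show ?thesis ..
  qed
  have pow_d: "(\<zeta> ^ r) ^ d = 1" for r
    by (metis \<zeta>_d power_commutes power_mult power_one mult.commute)
  have cnj_pow: "cnj ((\<zeta> ^ r) ^ j) * (\<zeta> ^ r) ^ j = 1" for r j
    using \<zeta>_cnj[of "r * j"] unfolding power_mult by (simp only: mult.commute)

  \<comment> \<open>The matrix of the clock to the power \<open>r\<close> followed by the shift by
    \<open>q\<close>: basis vector \<open>j\<close> goes to \<open>\<zeta> ^ (r * j)\<close> times
    basis vector \<open>j + q\<close>.\<close>
  define P where "P x i j = (case x of (q, r) \<Rightarrow> if i = (j + q) mod d then (\<zeta> ^ r) ^ j else 0)"
    for x :: "nat \<times> nat" and i j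
  have columns: "(\<Sum>k<d. cnj (P x k i) * P x k j) = (if i = j then 1 else 0)"
    if "i < d" "j < d" for x i j
  proof -
    obtain q r where x: "x = (q, r)" by (cases x)
    have eq: "(i + q) mod d = (j + q) mod d \<longleftrightarrow> i = j"
      using mod_add_left_inject[OF that, of q] by (simp add: add.commute)
    have "(\<Sum>k<d. cnj (P x k i) * P x k j) = (\<Sum>k<d. if k = (i + q) mod d then
        if i = j then 1 else 0 else 0)"
      by (intro sum.cong refl) (use eq cnj_pow in \<open>auto simp: x P_def simp del: complex_cnj_power\<close>)
    also have "\<dots> = (if i = j then 1 else 0)"
      using d by simp
    finally show ?thesis .
  qed
  have orth: "(\<Sum>i<d. \<Sum>j<d. cnj (P z i j) * P z' i j) = (if z = z' then of_nat d else 0)"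
    if "z \<in> Zd2 d" "z' \<in> Zd2 d" for z z'
  proof -
    obtain q r q' r' where z: "z = (q, r)" "z' = (q', r')" by (cases z, cases z')
    then have less: "q < d" "r < d" "q' < d" "r' < d"
      using that by (auto simp: Zd2_def)
    \<comment> \<open>The ratio of the two clock phases. For \<open>r \<noteq> r'\<close> it is a
      \<open>d\<close>-th root of unity other than 1, so its geometric sum vanishes.\<close>
    define u where "u = cnj (\<zeta> ^ r) * \<zeta> ^ r'"
    have "(\<Sum>i<d. \<Sum>j<d. cnj (P z i j) * P z' i j) = (\<Sum>j<d. \<Sum>i<d. cnj (P z i j) * P z' i j)"
      by (rule sum.swap)
    also have "\<dots> = (\<Sum>j<d. \<Sum>i<d. if i = (j + q) mod d then if q = q' then u ^ j else 0 else 0)"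
      by (intro sum.cong refl)
        (auto simp: z P_def u_def power_mult_distrib mod_add_left_inject less)
    also have "\<dots> = (if q = q' then \<Sum>j<d. u ^ j else 0)"
      using d by simp
    also have "(\<Sum>j<d. u ^ j) = (if r = r' then of_nat d else 0)"
    proof (cases "r = r'")
      case True
      then have "u = 1"
        using \<zeta>_cnj[of r] by (simp add: u_def mult.commute)
      then show ?thesis using True by simp
    next
      case False
      have "u \<noteq> 1"
      proof
        assume "u = 1"
        have "\<zeta> ^ r' = (\<zeta> ^ r * cnj (\<zeta> ^ r)) * \<zeta> ^ r'"
          by (simp only: \<zeta>_cnj mult_1_left)
        also have "\<dots> = \<zeta> ^ r * u"
          by (simp only: u_def mult.assoc)
        finally show False
          using \<zeta>_inj[OF less(2,4)] False \<open>u = 1\<close> by simp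
      qed
      moreover have "u ^ d = 1"
        unfolding u_def power_mult_distrib pow_d using pow_d[of r]
        by (metis complex_cnj_one complex_cnj_power mult_1_left)
      ultimately show ?thesis
        using False by (simp add: geometric_sum)
    qed
    finally show ?thesis
      by (auto simp: z)
  qed
  show ?thesis
  proof (rule dense_coding[OF dcb_add_Zd2[OF d(1)] _ _ card_Zd2 d columns columns orth])
    show "0 < card (Zd2 d)" "0 < card (Zd2 d)"
      using d by (auto simp: card_Zd2)
    show "\<exists>\<omega>. cmod \<omega> = 1 \<and> (\<forall>i<d. \<forall>j<d. (\<Sum>k<d. P x i k * P y k j)
        = \<omega> * P (add_Zd2 d x y) i j)" for x y
    proof -
      obtain q r s t where x: "x = (q, r)" "y = (s, t)" by (cases x, cases y)
      \<comment> \<open>The phase arises from moving the clock to the power \<open>r\<close> past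
        the shift by \<open>s\<close>.\<close>
      have "(\<Sum>k<d. P x i k * P y k j) = (\<zeta> ^ r) ^ s * P (add_Zd2 d x y) i j"
        if "i < d" "j < d" for i j
      proof -
        have "(\<Sum>k<d. P x i k * P y k j) = (\<Sum>k<d. if k = (j + s) mod d then
            P x i ((j + s) mod d) * (\<zeta> ^ t) ^ j else 0)"
          by (intro sum.cong refl) (auto simp: x P_def)
        also have "\<dots> = P x i ((j + s) mod d) * (\<zeta> ^ t) ^ j"
          using d by simp
        also have "\<dots> = (if i = (j + s + q) mod d then (\<zeta> ^ r) ^ (j + s) * (\<zeta> ^ t) ^ j else 0)"
          by (simp add: x P_def mod_simps pow_mod[OF pow_d])
        also have "\<dots> = (if i = (j + s + q) mod d then (\<zeta> ^ r) ^ s * (\<zeta> ^ (r + t)) ^ j else 0)"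
          by (simp add: power_add power_mult_distrib)
        also have "\<dots> = (\<zeta> ^ r) ^ s * P (add_Zd2 d x y) i j"
          by (simp add: x P_def add_Zd2_def mod_simps pow_mod[OF \<zeta>_d] add_ac)
        finally show ?thesis .
      qed
      moreover have "cmod ((\<zeta> ^ r) ^ s) = 1"
        by (simp add: \<zeta>_def norm_power)
      ultimately show ?thesis by blast
    qed
  qed
qed

text \<open>Division of \<open>q\<close> into blocks of length \<open>m\<close>: for every block \<open>k\<close> there is one \<open>s\<close> in that block for
  which the residues of \<open>q\<close> and \<open>s\<close> add up to the most likely value \<open>m - 1\<close>.\<close>

lemma block_partner:
  fixes q m k :: nat
  assumes "0 < m"
  defines "s \<equiv> k * m + (m - 1 - q mod m)"
  shows "s div m = k" "q + s = m * (q div m + s div m) + (m - 1)"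
proof -
  have "m - 1 - q mod m < m"
    using assms by simp
  then show *: "s div m = k"
    unfolding s_def by simp
  have "q mod m \<le> m - 1"
    using assms by (simp add: Suc_leI less_Suc_eq_le[symmetric])
  then have "q + s = (q div m * m + q mod m) + (k * m + (m - 1 - q mod m))"
    by (simp add: s_def)
  also have "\<dots> = m * (q div m + k) + (m - 1)"
    using \<open>q mod m \<le> m - 1\<close> by (simp only: add_mult_distrib2 mult.commute)
  finally show "q + s = m * (q div m + s div m) + (m - 1)"
    by (simp only: *)
qed

text \<open>For fixed \<open>x\<close>, each of the \<open>e1 * e2\<close> pairs of blocks contains
  an input \<open>y\<close> on which the guess is right, so at least \<open>d1\<close> of the
  \<open>d\<^sup>2\<close> inputs \<open>y\<close> succeed. By \<open>d1 \<le> d2\<close> both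
  parties can use the same encoding.\<close>

lemma Zd2_C_set:
  assumes d: "0 < d" and e: "e1 dvd d" "e2 dvd d" and d1: "d1 = e1 * e2" and d2: "d1 \<le> d2"
  shows "\<exists>Q\<in>C_set (Zd2 d) (Zd2 d) (Zd2 d) d1 d2.
    real d1 / real (d\<^sup>2) \<le> succ_prob (Zd2 d) (Zd2 d) (add_Zd2 d) Q"
proof -
  obtain m1 m2 where m: "d = e1 * m1" "d = e2 * m2"
    using e by (blast elim: dvdE)
  with d have pos: "0 < m1" "0 < m2" "0 < e1" "0 < e2"
    by (auto intro!: Nat.gr0I)
  define \<alpha> where "\<alpha> x = (case x of (q, r) \<Rightarrow> q div m1 * e2 + r div m2)" for x
  \<comment> \<open>Adds the starting points of the blocks and guesses that the offsets within them
    sum to \<open>m1 - 1\<close> and \<open>m2 - 1\<close>.\<close>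
  define dec where "dec a b = ((m1 * (a div e2 + b div e2) + (m1 - 1)) mod d,
      (m2 * (a mod e2 + b mod e2) + (m2 - 1)) mod d)" for a b
  define Q where "Q x y z = (if z = dec (\<alpha> x) (\<alpha> y) then 1 else 0 :: real)" for x y z
  have block_less: "q div m1 < e1" "q div m2 < e2" if "q < d" for q
    using that m by (auto intro: less_mult_imp_div_less)
  have \<alpha>_less: "\<alpha> x < d1" if "x \<in> Zd2 d" for x
    using that block_less by (auto simp: \<alpha>_def d1 Zd2_def intro!: pair_index_less)
  have \<alpha>_div: "\<alpha> (q, r) div e2 = q div m1" "\<alpha> (q, r) mod e2 = r div m2" if "r < d" for q r
    using block_less(2)[OF that] by (auto simp: \<alpha>_def)
  have dec_in: "dec a b \<in> Zd2 d" for a b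
    using d by (simp add: dec_def Zd2_def)

  have "Q \<in> C_set (Zd2 d) (Zd2 d) (Zd2 d) d1 d2"
    unfolding C_set_def
  proof (intro CollectI exI conjI ballI allI impI)
    show "prob_dist {..<d1} (\<lambda>a. if a = \<alpha> x then 1 else 0)" if "x \<in> Zd2 d" for x
      using \<alpha>_less[OF that] by (simp add: prob_dist_def)
    show "prob_dist {..<d2} (\<lambda>b. if b = \<alpha> y then 1 else 0)" if "y \<in> Zd2 d" for y
      using \<alpha>_less[OF that] d2 by (simp add: prob_dist_def)
    show "prob_dist (Zd2 d) (\<lambda>z. if z = dec a b then 1 else 0)" for a b
      using dec_in finite_Zd2 by (simp add: prob_dist_def)
    fix x y z assume xy: "x \<in> Zd2 d" "y \<in> Zd2 d"
    have "(\<Sum>a<d1. \<Sum>b<d2. (if z = dec a b then 1 else 0) * (if a = \<alpha> x then 1 else 0) *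
        (if b = \<alpha> y then 1 else 0))
      = (\<Sum>a<d1. \<Sum>b<d2. if b = \<alpha> y then if a = \<alpha> x then Q x y z else 0 else 0)"
      by (intro sum.cong refl) (simp add: Q_def)
    also have "\<dots> = Q x y z"
      using \<alpha>_less[OF xy(1)] \<alpha>_less[OF xy(2)] d2 by simp
    finally show "Q x y z = (\<Sum>a<d1. \<Sum>b<d2. (if z = dec a b then 1 else 0) *
        (if a = \<alpha> x then 1 else 0) * (if b = \<alpha> y then 1 else 0))" ..
  qed
  moreover have "real d1 / real (d\<^sup>2) \<le> succ_prob (Zd2 d) (Zd2 d) (add_Zd2 d) Q"
  proof -
    have row: "real d1 \<le> (\<Sum>y\<in>Zd2 d. Q x y (add_Zd2 d x y))" if x: "x \<in> Zd2 d" for x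
    proof -
      obtain q r where qr: "x = (q, r)" "q < d" "r < d"
        using x by (auto simp: Zd2_def)
      \<comment> \<open>Maps a pair of block numbers to the \<open>y\<close> in these blocks whose
        offsets complement those of \<open>x\<close>. Division recovers the block numbers, hence
        injectivity.\<close>
      define g where "g = (\<lambda>(k, l). (k * m1 + (m1 - 1 - q mod m1), l * m2 + (m2 - 1 - r mod m2)))"
      note partner = block_partner[OF pos(1), where q = q] block_partner[OF pos(2), where q = r]
      have inj: "inj_on g ({..<e1} \<times> {..<e2})"
        unfolding inj_on_def g_def using partner(1,3) by (auto, metis+)
      have sub: "g ` ({..<e1} \<times> {..<e2}) \<subseteq> {y \<in> Zd2 d. add_Zd2 d x y = dec (\<alpha> x) (\<alpha> y)}"
      proof
        fix y assume "y \<in> g ` ({..<e1} \<times> {..<e2})"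
        then obtain k l where kl: "k < e1" "l < e2" "y = g (k, l)" by auto
        define s where "s = k * m1 + (m1 - 1 - q mod m1)"
        define t where "t = l * m2 + (m2 - 1 - r mod m2)"
        have y: "y = (s, t)"
          by (simp add: kl(3) g_def s_def t_def)
        have "s < e1 * m1" "t < e2 * m2"
          unfolding s_def t_def using kl pos by (auto intro!: pair_index_less)
        then have st: "s < d" "t < d"
          by (simp_all only: m(1)[symmetric] m(2)[symmetric])
        moreover have "q + s = m1 * (q div m1 + s div m1) + (m1 - 1)"
          "r + t = m2 * (r div m2 + t div m2) + (m2 - 1)"
          using partner(2)[of k] partner(4)[of l] unfolding s_def t_def by blast+
        then have "add_Zd2 d x y = dec (\<alpha> x) (\<alpha> y)"
          by (simp add: qr y add_Zd2_def dec_def \<alpha>_div qr st)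
        ultimately show "y \<in> {y \<in> Zd2 d. add_Zd2 d x y = dec (\<alpha> x) (\<alpha> y)}"
          by (simp add: y Zd2_def)
      qed
      have "d1 = card (g ` ({..<e1} \<times> {..<e2}))"
        by (simp add: card_image[OF inj] d1)
      also have "\<dots> \<le> card {y \<in> Zd2 d. add_Zd2 d x y = dec (\<alpha> x) (\<alpha> y)}"
        using sub finite_Zd2 by (intro card_mono) auto
      finally have "real d1 \<le> (\<Sum>y\<in>{y \<in> Zd2 d. add_Zd2 d x y = dec (\<alpha> x) (\<alpha> y)}. 1)"
        by simp
      also have "\<dots> = (\<Sum>y\<in>Zd2 d. Q x y (add_Zd2 d x y))"
        unfolding Q_def using finite_Zd2 by (subst sum.inter_filter) auto
      finally show ?thesis .
    qed
    have "real (d\<^sup>2) * real d1 = (\<Sum>x\<in>Zd2 d. real d1)"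
      by (simp add: card_Zd2)
    also have "\<dots> \<le> (\<Sum>x\<in>Zd2 d. \<Sum>y\<in>Zd2 d. Q x y (add_Zd2 d x y))"
      by (intro sum_mono row)
    finally have "real (d\<^sup>2) * real d1 / (real (d\<^sup>2) * real (d\<^sup>2))
        \<le> succ_prob (Zd2 d) (Zd2 d) (add_Zd2 d) Q"
      unfolding succ_prob_def card_Zd2 by (intro divide_right_mono) auto
    moreover have "real (d\<^sup>2) \<noteq> 0"
      using d by simp
    ultimately show ?thesis
      by (metis nonzero_mult_divide_mult_cancel_left)
  qed
  ultimately show ?thesis by blast
qed

subsection \<open>Suprema\<close>

text \<open>Needed because a real supremum over the empty set is no least upper bound; the
  inclusions pass nonemptiness on to the larger sets.\<close>

lemma C_set_nonempty:
  assumes "0 < d1" "0 < d2" "z0 \<in> Z" "finite Z"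
  shows "C_set X Y Z d1 d2 \<noteq> {}"
proof -
  have "(\<lambda>x y z. \<Sum>a<d1. \<Sum>b<d2. (if z = z0 then 1 else 0) * (if a = 0 then 1 else 0) *
      (if b = 0 then 1 else 0)) \<in> C_set X Y Z d1 d2"
    unfolding C_set_def using assms
    by (intro CollectI exI[of _ "\<lambda>_ a. if a = 0 then 1 else 0"] exI[of _ "\<lambda>_ _ z. if z = z0 then 1 else 0"])
      (simp add: prob_dist_def)
  then show ?thesis by blast
qed

lemma succ_sup_le:
  assumes "S \<noteq> {}" "\<And>Q. Q \<in> S \<Longrightarrow> succ_prob X Y f Q \<le> c"
  shows "succ_sup X Y f S \<le> c"
  unfolding succ_sup_def using assms by (intro cSUP_least)

lemma succ_sup_eq:
  assumes "\<And>Q. Q \<in> S \<Longrightarrow> succ_prob X Y f Q \<le> c" "\<exists>Q\<in>S. c \<le> succ_prob X Y f Q"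
  shows "succ_sup X Y f S = c"
proof (rule antisym)
  show "succ_sup X Y f S \<le> c"
    using assms by (intro succ_sup_le) auto
  obtain Q where Q: "Q \<in> S" "c \<le> succ_prob X Y f Q"
    using assms(2) by blast
  have "bdd_above (succ_prob X Y f ` S)"
    using assms(1) by (intro bdd_aboveI2)
  then have "succ_prob X Y f Q \<le> succ_sup X Y f S"
    unfolding succ_sup_def using Q(1) by (intro cSUP_upper)
  then show "c \<le> succ_sup X Y f S"
    using Q(2) by simp
qed

theorem theorem9:
  fixes d d1 d2 :: nat
    and X :: "'x set" and Y :: "'y set" and Z :: "'z set" and f :: "'x \<Rightarrow> 'y \<Rightarrow> 'z"
    and G :: "('g, 'm) monoid_scheme"
  assumes "0 < d" and "d \<le> d1" and "d1 < d\<^sup>2" and "d \<le> d2" and "d2 < d\<^sup>2"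
  shows "(dcb_of_order (d\<^sup>2) X Y Z f \<and> tnc d G \<and> group_table G X Y Z f \<longrightarrow>
            Max {succ_sup X Y f (C_set X Y Z d1 d2), succ_sup X Y f (CE_set X Y Z d1 d2),
                 succ_sup X Y f (CN_set X Y Z d1 d2), succ_sup X Y f (Q_set X Y Z d1 d2)}
              \<le> real (min d1 d2) / real (d\<^sup>2) \<and>
            real (min d1 d2) / real (d\<^sup>2) < 1 \<and>
            succ_sup X Y f (QE_set X Y Z d1 d2) = 1)
       \<and> ((\<exists>d1' d2' d3' d4' :: nat. d1' \<le> d3' \<and> d2' \<le> d4' \<and>
               d1' dvd d \<and> d2' dvd d \<and> d3' dvd d \<and> d4' dvd d \<and>
               d1 = d1' * d2' \<and> d2 = d3' * d4') \<longrightarrow>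
            (let W = Zd2 d; g = add_Zd2 d in
            succ_sup W W g (C_set W W W d1 d2) = real (min d1 d2) / real (d\<^sup>2) \<and>
            succ_sup W W g (CE_set W W W d1 d2) = real (min d1 d2) / real (d\<^sup>2) \<and>
            succ_sup W W g (CN_set W W W d1 d2) = real (min d1 d2) / real (d\<^sup>2) \<and>
            succ_sup W W g (Q_set W W W d1 d2) = real (min d1 d2) / real (d\<^sup>2) \<and>
            real (min d1 d2) / real (d\<^sup>2) < 1 \<and>
            succ_sup W W g (QE_set W W W d1 d2) = 1))"
proof (intro conjI impI)
  have pos: "0 < d\<^sup>2"
    using assms by simp
  show lt: "real (min d1 d2) / real (d\<^sup>2) < 1"
    using assms pos by (simp add: divide_less_eq_1 min_def flip: of_nat_power)
  {
    assume *: "dcb_of_order (d\<^sup>2) X Y Z f \<and> tnc d G \<and> group_table G X Y Z f"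
    then have dcb: "dcb X Y Z f" and X: "card X = d\<^sup>2"
      by (auto simp: dcb_of_order_def)
    have cards: "card X = card (carrier G)" "card Y = card (carrier G)" "card Z = card (carrier G)"
      using * by (auto simp: group_table_def dest: bij_betw_same_card)
    with X have Y: "card Y = d\<^sup>2" and Z: "card Z = d\<^sup>2" by auto
    obtain z0 where "z0 \<in> Z"
      using Z pos by fastforce
    then have ne: "C_set X Y Z d1 d2 \<noteq> {}"
      using assms dcb by (intro C_set_nonempty) (auto simp: dcb_def)
    note CN = CN_set_succ_prob_le[OF dcb X Y pos] and Q = Q_set_succ_prob_le[OF dcb X Y pos]
    \<comment> \<open>The inclusions carry the bound for the nonsignaling set down to the classical
      and entangled ones.\<close>
    note sub = C_set_subset_CE_set[of X Y Z d1 d2] CE_set_subset_CN_set[of X Y Z d1 d2]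
      C_set_subset_Q_set[of X Y Z d1 d2]
    have "succ_sup X Y f (C_set X Y Z d1 d2) \<le> real (min d1 d2) / real (d\<^sup>2)"
      "succ_sup X Y f (CE_set X Y Z d1 d2) \<le> real (min d1 d2) / real (d\<^sup>2)"
      "succ_sup X Y f (CN_set X Y Z d1 d2) \<le> real (min d1 d2) / real (d\<^sup>2)"
      "succ_sup X Y f (Q_set X Y Z d1 d2) \<le> real (min d1 d2) / real (d\<^sup>2)"
      using ne sub by (blast intro!: succ_sup_le intro: CN Q)+
    then show "Max {succ_sup X Y f (C_set X Y Z d1 d2), succ_sup X Y f (CE_set X Y Z d1 d2),
        succ_sup X Y f (CN_set X Y Z d1 d2), succ_sup X Y f (Q_set X Y Z d1 d2)}
        \<le> real (min d1 d2) / real (d\<^sup>2)"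
      by simp
    have "\<exists>Q\<in>QE_set X Y Z d1 d2. succ_prob X Y f Q = 1"
      using * dcb assms by (intro tnc_QE_set[of d G]) auto
    then show "succ_sup X Y f (QE_set X Y Z d1 d2) = 1"
      using QE_set_succ_prob_le_1[OF dcb] by (intro succ_sup_eq; metis order_refl)
  }
  assume "\<exists>d1' d2' d3' d4' :: nat. d1' \<le> d3' \<and> d2' \<le> d4' \<and>
      d1' dvd d \<and> d2' dvd d \<and> d3' dvd d \<and> d4' dvd d \<and> d1 = d1' * d2' \<and> d2 = d3' * d4'"
  \<comment> \<open>Multiplying the inequalities between the factors gives
    \<open>d1 \<le> d2\<close>, so the minimum is \<open>d1\<close> and the block strategy with
    \<open>d1'\<close> and \<open>d2'\<close> attains it.\<close>
  then obtain e1 e2 where e: "e1 dvd d" "e2 dvd d" "d1 = e1 * e2" and "d1 \<le> d2"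
    by (auto intro: mult_le_mono)
  let ?W = "Zd2 d"
  note dcb = dcb_add_Zd2[OF assms(1)]
  obtain Q0 where Q0: "Q0 \<in> C_set ?W ?W ?W d1 d2"
    "real (min d1 d2) / real (d\<^sup>2) \<le> succ_prob ?W ?W (add_Zd2 d) Q0"
    using Zd2_C_set[OF assms(1) e \<open>d1 \<le> d2\<close>] \<open>d1 \<le> d2\<close> by (auto simp: min_def)
  note CN = CN_set_succ_prob_le[OF dcb card_Zd2 card_Zd2 pos]
    and Q = Q_set_succ_prob_le[OF dcb card_Zd2 card_Zd2 pos]
  note sub = C_set_subset_CE_set[of ?W ?W ?W d1 d2] CE_set_subset_CN_set[of ?W ?W ?W d1 d2]
    C_set_subset_Q_set[of ?W ?W ?W d1 d2]
  have "succ_sup ?W ?W (add_Zd2 d) (C_set ?W ?W ?W d1 d2) = real (min d1 d2) / real (d\<^sup>2)"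
    "succ_sup ?W ?W (add_Zd2 d) (CE_set ?W ?W ?W d1 d2) = real (min d1 d2) / real (d\<^sup>2)"
    "succ_sup ?W ?W (add_Zd2 d) (CN_set ?W ?W ?W d1 d2) = real (min d1 d2) / real (d\<^sup>2)"
    "succ_sup ?W ?W (add_Zd2 d) (Q_set ?W ?W ?W d1 d2) = real (min d1 d2) / real (d\<^sup>2)"
    using Q0 sub by (blast intro!: succ_sup_eq intro: CN Q)+
  moreover have "succ_sup ?W ?W (add_Zd2 d) (QE_set ?W ?W ?W d1 d2) = 1"
    using QE_set_succ_prob_le_1[OF dcb] Zd2_QE_set[OF assms(1,2,4)]
    by (intro succ_sup_eq; metis order_refl)
  ultimately show "let W = Zd2 d; g = add_Zd2 d in
      succ_sup W W g (C_set W W W d1 d2) = real (min d1 d2) / real (d\<^sup>2) \<and>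
      succ_sup W W g (CE_set W W W d1 d2) = real (min d1 d2) / real (d\<^sup>2) \<and>
      succ_sup W W g (CN_set W W W d1 d2) = real (min d1 d2) / real (d\<^sup>2) \<and>
      succ_sup W W g (Q_set W W W d1 d2) = real (min d1 d2) / real (d\<^sup>2) \<and>
      real (min d1 d2) / real (d\<^sup>2) < 1 \<and>
      succ_sup W W g (QE_set W W W d1 d2) = 1"
    unfolding Let_def using lt by blast
qed

end
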